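(* Let $k$ be a commutative ring with identity, let $\mathcal{C}$ be a small category, and let $\mathfrak{R}:\mathcal{C}^{op}\to k\text{-Alg}$ be a presheaf of unital $k$-algebras on $\mathcal{C}$. If $\mathrm{Ob}\,\mathcal{C}$ is finite, then there is an equivalence of categories $$\mathfrak{M}od\text{-}\mathfrak{R}\;\simeq\;\mathrm{Mod}\text{-}\mathfrak{R}[\mathcal{C}],$$ where $\mathfrak{M}od\text{-}\mathfrak{R}$ is the category of presheaves of right $\mathfrak{R}$-modules on $\mathcal{C}$ and $\mathrm{Mod}\text{-}\mathfrak{R}[\mathcal{C}]$ is the category of right modules over the skew category algebra $\mathfrak{R}[\mathcal{C}]$.
   Context: $k\text{-Alg}$ is the category of unital associative $k$-algebras and unital $k$-algebra homomorphisms. All modules are right modules (unital over unital algebras). A (presheaf of) right $\mathfrak{R}$-module(s) is a functor $\mathfrak{M}:\mathcal{C}^{op}\to \mathrm{Mod}\text{-}k$ together with a right $\mathfrak{R}(x)$-module structure on $\mathfrak{M}(x)$ (compatible with its $k$-module structure) for each object $x$, such that $\mathfrak{M}(f)(m\cdot s)=\mathfrak{M}(f)(m)\cdot\mathfrak{R}(f)(s)$ for every morphism $f:x\to y$, $m\in\mathfrak{M}(y)$, $s\in\mathfrak{R}(y)$. Morphisms are natural transformations that are $\mathfrak{R}(x)$-linear at each object $x$. (Here $\mathcal{C}$ carries the minimal Grothendieck topology, so that all presheaves are sheaves.) Skew category algebra: $\mathfrak{R}[\mathcal{C}]$ is the $k$-module $\bigoplus_{f\in\mathrm{Mor}\,\mathcal{C}}\mathfrak{R}(\mathrm{dom}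 f)\,f$, spanned by elements $rf$ with $f\in \mathrm{Mor}\,\mathcal{C}$ and $r\in\mathfrak{R}(\mathrm{dom}(f))$, with multiplication extended linearly from $$sg * rf=\begin{cases}(\mathfrak{R}(f)(s)\,r)\,gf, & \text{if } \mathrm{dom}(g)=\mathrm{cod}(f),\\ 0,&\text{otherwise.}\end{cases}$$ It is an associative $k$-algebra; if $\mathrm{Ob}\,\mathcal{C}$ is finite it has identity $\sum_{x\in\mathrm{Ob}\,\mathcal{C}}1_{\mathfrak{R}(x)}1_x$. If $\mathcal{C}$ is empty, it is the zero ring. *)

theory Defs
  imports "HOL-Algebra.Module" "HOL-Library.FuncSet"
begin

section \<open>Categories, functors, natural transformations\<close>

record ('o, 'a) category =
  Obj :: "'o set"
  Arr :: "'a set"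
  Dom :: "'a \<Rightarrow> 'o"
  Cod :: "'a \<Rightarrow> 'o"
  Id :: "'o \<Rightarrow> 'a"
  Comp :: "'a \<Rightarrow> 'a \<Rightarrow> 'a"

text \<open>\<open>Comp C g f\<close> is \<open>g\<close> after \<open>f\<close>; it is meaningful if \<open>Dom C g = Cod C f\<close>.\<close>

locale category =
  fixes C :: "('o, 'a) category"
  assumes Dom_closed: "f \<in> Arr C \<Longrightarrow> Dom C f \<in> Obj C"
    and Cod_closed: "f \<in> Arr C \<Longrightarrow> Cod C f \<in> Obj C"
    and Id_closed: "x \<in> Obj C \<Longrightarrow> Id C x \<in> Arr C"
    and Dom_Id: "x \<in> Obj C \<Longrightarrow> Dom C (Id C x) = x"
    and Cod_Id: "x \<in> Obj C \<Longrightarrow> Cod C (Id C x) = x"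
    and Comp_closed: "\<lbrakk>g \<in> Arr C; f \<in> Arr C; Dom C g = Cod C f\<rbrakk> \<Longrightarrow> Comp C g f \<in> Arr C"
    and Dom_Comp: "\<lbrakk>g \<in> Arr C; f \<in> Arr C; Dom C g = Cod C f\<rbrakk> \<Longrightarrow> Dom C (Comp C g f) = Dom C f"
    and Cod_Comp: "\<lbrakk>g \<in> Arr C; f \<in> Arr C; Dom C g = Cod C f\<rbrakk> \<Longrightarrow> Cod C (Comp C g f) = Cod C g"
    and Comp_Id: "f \<in> Arr C \<Longrightarrow> Comp C f (Id C (Dom C f)) = f"
    and Id_Comp: "f \<in> Arr C \<Longrightarrow> Comp C (Id C (Cod C f)) f = f"
    and Comp_assoc: "\<lbrakk>h \<in> Arr C; g \<in> Arr C; f \<in> Arr C; Dom C h = Cod C g; Dom C g = Cod C f\<rbrakk>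
      \<Longrightarrow> Comp C (Comp C h g) f = Comp C h (Comp C g f)"

definition opposite :: "('o, 'a) category \<Rightarrow> ('o, 'a) category" where
  "opposite C = \<lparr>Obj = Obj C, Arr = Arr C, Dom = Cod C, Cod = Dom C, Id = Id C,
     Comp = (\<lambda>g f. Comp C f g)\<rparr>"

definition iso_arr :: "('o, 'a) category \<Rightarrow> 'a \<Rightarrow> bool" where
  "iso_arr C f \<longleftrightarrow> f \<in> Arr C \<and> (\<exists>g \<in> Arr C. Dom C g = Cod C f \<and> Cod C g = Dom C f \<and>
     Comp C g f = Id C (Dom C f) \<and> Comp C f g = Id C (Cod C f))"

record ('o, 'a, 'p, 'b) func =
  fobj :: "'o \<Rightarrow> 'p"
  farr :: "'a \<Rightarrow> 'b"

locale cfunctor = C: category C + D: category D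
  for C :: "('o, 'a) category" and D :: "('p, 'b) category" +
  fixes F :: "('o, 'a, 'p, 'b, 'z) func_scheme"
  assumes fobj_closed: "x \<in> Obj C \<Longrightarrow> fobj F x \<in> Obj D"
    and farr_closed: "f \<in> Arr C \<Longrightarrow> farr F f \<in> Arr D"
    and Dom_farr: "f \<in> Arr C \<Longrightarrow> Dom D (farr F f) = fobj F (Dom C f)"
    and Cod_farr: "f \<in> Arr C \<Longrightarrow> Cod D (farr F f) = fobj F (Cod C f)"
    and farr_Id: "x \<in> Obj C \<Longrightarrow> farr F (Id C x) = Id D (fobj F x)"
    and farr_Comp: "\<lbrakk>g \<in> Arr C; f \<in> Arr C; Dom C g = Cod C f\<rbrakk>
      \<Longrightarrow> farr F (Comp C g f) = Comp D (farr F g) (farr F f)"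

definition id_func :: "('o, 'a, 'o, 'a) func" where
  "id_func = \<lparr>fobj = (\<lambda>x. x), farr = (\<lambda>f. f)\<rparr>"

definition comp_func ::
    "('p, 'b, 'q, 'c) func \<Rightarrow> ('o, 'a, 'p, 'b) func \<Rightarrow> ('o, 'a, 'q, 'c) func" where
  "comp_func G F = \<lparr>fobj = (\<lambda>x. fobj G (fobj F x)), farr = (\<lambda>f. farr G (farr F f))\<rparr>"

locale nat_trans = F: cfunctor C D F + G: cfunctor C D G
  for C :: "('o, 'a) category" and D :: "('p, 'b) category"
    and F :: "('o, 'a, 'p, 'b, 'y) func_scheme" and G :: "('o, 'a, 'p, 'b, 'z) func_scheme" +
  fixes T :: "'o \<Rightarrow> 'b"
  assumes component_closed: "x \<in> Obj C \<Longrightarrow> T x \<in> Arr D"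
    and Dom_component: "x \<in> Obj C \<Longrightarrow> Dom D (T x) = fobj F x"
    and Cod_component: "x \<in> Obj C \<Longrightarrow> Cod D (T x) = fobj G x"
    and naturality: "f \<in> Arr C
      \<Longrightarrow> Comp D (farr G f) (T (Dom C f)) = Comp D (T (Cod C f)) (farr F f)"

definition nat_isomorphic ::
    "('o, 'a) category \<Rightarrow> ('p, 'b) category \<Rightarrow> ('o, 'a, 'p, 'b) func \<Rightarrow> ('o, 'a, 'p, 'b) func \<Rightarrow> bool"
  where "nat_isomorphic C D F G \<longleftrightarrow>
    (\<exists>T. nat_trans C D F G T \<and> (\<forall>x \<in> Obj C. iso_arr D (T x)))"

definition equivalent_categories :: "('o, 'a) category \<Rightarrow> ('p, 'b) category \<Rightarrow> bool" where
  "equivalent_categories C D \<longleftrightarrow> (\<exists>F G. cfunctor C D F \<and> cfunctor D C G \<and>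
     nat_isomorphic C C id_func (comp_func G F) \<and> nat_isomorphic D D (comp_func F G) id_func)"


section \<open>Algebras and modules\<close>

text \<open>An arrow of a category of structured objects carries its source and target.\<close>

datatype ('o, 'f) arrow = Arrow (src: 'o) (trg: 'o) (fn: 'f)

text \<open>
  The category of structured sets \<open>A \<in> Ob\<close> with underlying sets \<open>car A\<close> and structure-preserving
  maps \<open>H A B\<close>. Maps are taken extensional, so that equality of arrows is equality of functions
  on the underlying set.
\<close>

definition concrete_category ::
    "'o set \<Rightarrow> ('o \<Rightarrow> 'e set) \<Rightarrow> ('o \<Rightarrow> 'o \<Rightarrow> ('e \<Rightarrow> 'e) set) \<Rightarrow> ('o, ('o, 'e \<Rightarrow> 'e) arrow) category"
  where "concrete_category Ob car H = \<lparr>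
    Obj = Ob,
    Arr = {Arrow A B h | A B h. A \<in> Ob \<and> B \<in> Ob \<and> h \<in> H A B \<and> h \<in> extensional (car A)},
    Dom = src,
    Cod = trg,
    Id = (\<lambda>A. Arrow A A (\<lambda>a\<in>car A. a)),
    Comp = (\<lambda>g f. Arrow (src f) (trg g) (compose (car (src f)) (fn g) (fn f)))\<rparr>"

text \<open>
  Unital associative, not necessarily commutative, algebras (the locale \<open>algebra\<close> of HOL-Algebra
  is restricted to commutative ones).
\<close>

locale assoc_algebra = module k A + A: ring A
  for k :: "'k ring" and A :: "('k, 'r) module" +
  assumes smult_mult_l: "\<lbrakk>c \<in> carrier k; a \<in> carrier A; b \<in> carrier A\<rbrakk>
      \<Longrightarrow> (c \<odot>\<^bsub>A\<^esub> a) \<otimes>\<^bsub>A\<^esub> b = c \<odot>\<^bsub>A\<^esub> (a \<otimes>\<^bsub>A\<^esub> b)"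
    and smult_mult_r: "\<lbrakk>c \<in> carrier k; a \<in> carrier A; b \<in> carrier A\<rbrakk>
      \<Longrightarrow> a \<otimes>\<^bsub>A\<^esub> (c \<odot>\<^bsub>A\<^esub> b) = c \<odot>\<^bsub>A\<^esub> (a \<otimes>\<^bsub>A\<^esub> b)"

definition algebra_hom :: "'k ring \<Rightarrow> ('k, 'r) module \<Rightarrow> ('k, 'r) module \<Rightarrow> ('r \<Rightarrow> 'r) set" where
  "algebra_hom k A B = {h \<in> ring_hom A B.
     \<forall>c \<in> carrier k. \<forall>a \<in> carrier A. h (c \<odot>\<^bsub>A\<^esub> a) = c \<odot>\<^bsub>B\<^esub> h a}"

type_synonym ('k, 'r) alg_arrow = "(('k, 'r) module, 'r \<Rightarrow> 'r) arrow"

definition alg_category :: "'k ring \<Rightarrow> (('k, 'r) module, ('k, 'r) alg_arrow) category" where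
  "alg_category k = concrete_category {A. assoc_algebra k A} carrier (algebra_hom k)"

text \<open>
  In all module records, only the additive group and the scalar action matter; as usual in
  HOL-Algebra, the multiplicative fields inherited from \<open>ring\<close> are unconstrained. Modules over the
  commutative ring \<open>k\<close> are those of HOL-Algebra, with scalars written on the left.
\<close>

definition additive_hom :: "('a, 'y) ring_scheme \<Rightarrow> ('b, 'z) ring_scheme \<Rightarrow> ('a \<Rightarrow> 'b) set" where
  "additive_hom M N = {h \<in> carrier M \<rightarrow> carrier N.
     \<forall>m \<in> carrier M. \<forall>n \<in> carrier M. h (m \<oplus>\<^bsub>M\<^esub> n) = h m \<oplus>\<^bsub>N\<^esub> h n}"

definition kmod_hom :: "'k ring \<Rightarrow> ('k, 'm) module \<Rightarrow> ('k, 'm) module \<Rightarrow> ('m \<Rightarrow> 'm) set" where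
  "kmod_hom k M N = {h \<in> additive_hom M N.
     \<forall>c \<in> carrier k. \<forall>m \<in> carrier M. h (c \<odot>\<^bsub>M\<^esub> m) = c \<odot>\<^bsub>N\<^esub> h m}"

type_synonym ('k, 'm) kmod_arrow = "(('k, 'm) module, 'm \<Rightarrow> 'm) arrow"

definition kmod_category :: "'k ring \<Rightarrow> (('k, 'm) module, ('k, 'm) kmod_arrow) category" where
  "kmod_category k = concrete_category {M. module k M} carrier (kmod_hom k)"

text \<open>\<open>right_module A M act\<close>: the map \<open>act\<close> is a unital right \<open>A\<close>-module structure on the additive
  group of \<open>M\<close>.\<close>

locale right_module = A: ring A + M: abelian_group M
  for A :: "('r, 'y) ring_scheme" and M :: "('m, 'z) ring_scheme" +
  fixes act :: "'m \<Rightarrow> 'r \<Rightarrow> 'm"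
  assumes act_closed: "\<lbrakk>m \<in> carrier M; a \<in> carrier A\<rbrakk> \<Longrightarrow> act m a \<in> carrier M"
    and act_add_l: "\<lbrakk>m \<in> carrier M; n \<in> carrier M; a \<in> carrier A\<rbrakk>
      \<Longrightarrow> act (m \<oplus>\<^bsub>M\<^esub> n) a = act m a \<oplus>\<^bsub>M\<^esub> act n a"
    and act_add_r: "\<lbrakk>m \<in> carrier M; a \<in> carrier A; b \<in> carrier A\<rbrakk>
      \<Longrightarrow> act m (a \<oplus>\<^bsub>A\<^esub> b) = act m a \<oplus>\<^bsub>M\<^esub> act m b"
    and act_mult: "\<lbrakk>m \<in> carrier M; a \<in> carrier A; b \<in> carrier A\<rbrakk>
      \<Longrightarrow> act m (a \<otimes>\<^bsub>A\<^esub> b) = act (act m a) b"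
    and act_one: "m \<in> carrier M \<Longrightarrow> act m \<one>\<^bsub>A\<^esub> = m"

text \<open>
  The category of right modules over a ring. The type \<open>'m\<close> of module elements plays the role of the
  universe: the objects are the modules whose underlying set is a subset of \<open>'m\<close>. If \<open>'m\<close> is
  infinite, this universe is closed (up to isomorphism) under finite direct sums.
\<close>

record ('r, 'm) rmodule = "'m ring" +
  ract :: "'m \<Rightarrow> 'r \<Rightarrow> 'm"

definition rmod_hom ::
    "('r, 'y) ring_scheme \<Rightarrow> ('r, 'm) rmodule \<Rightarrow> ('r, 'm) rmodule \<Rightarrow> ('m \<Rightarrow> 'm) set" where
  "rmod_hom A M N = {h \<in> additive_hom M N.
     \<forall>m \<in> carrier M. \<forall>a \<in> carrier A. h (ract M m a) = ract N (h m) a}"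

type_synonym ('r, 'm) rmod_arrow = "(('r, 'm) rmodule, 'm \<Rightarrow> 'm) arrow"

definition rmod_category ::
    "('r, 'y) ring_scheme \<Rightarrow> (('r, 'm) rmodule, ('r, 'm) rmod_arrow) category" where
  "rmod_category A = concrete_category {M. right_module A M (ract M)} carrier (rmod_hom A)"


section \<open>Presheaves of algebras and of modules\<close>

type_synonym ('o, 'c, 'k, 'r) alg_presheaf = "('o, 'c, ('k, 'r) module, ('k, 'r) alg_arrow) func"

definition presheaf_of_algebras ::
    "'k ring \<Rightarrow> ('o, 'c) category \<Rightarrow> ('o, 'c, 'k, 'r) alg_presheaf \<Rightarrow> bool" where
  "presheaf_of_algebras k C R \<longleftrightarrow> cfunctor (opposite C) (alg_category k) R"

record ('o, 'c, 'k, 'r, 'm) pmodule = "('o, 'c, ('k, 'm) module, ('k, 'm) kmod_arrow) func" +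
  pact :: "'o \<Rightarrow> 'm \<Rightarrow> 'r \<Rightarrow> 'm"

locale presheaf_module = M: cfunctor "opposite C" "kmod_category k" M
  for k :: "'k ring" and C :: "('o, 'c) category" and R :: "('o, 'c, 'k, 'r) alg_presheaf"
    and M :: "('o, 'c, 'k, 'r, 'm) pmodule" +
  assumes right_module: "x \<in> Obj C \<Longrightarrow> right_module (fobj R x) (fobj M x) (pact M x)"
    and pact_smult: "\<lbrakk>x \<in> Obj C; c \<in> carrier k; m \<in> carrier (fobj M x); s \<in> carrier (fobj R x)\<rbrakk>
      \<Longrightarrow> pact M x m (c \<odot>\<^bsub>fobj R x\<^esub> s) = c \<odot>\<^bsub>fobj M x\<^esub> pact M x m s"
    and smult_pact: "\<lbrakk>x \<in> Obj C; c \<in> carrier k; m \<in> carrier (fobj M x); s \<in> carrier (fobj R x)\<rbrakk>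
      \<Longrightarrow> pact M x (c \<odot>\<^bsub>fobj M x\<^esub> m) s = c \<odot>\<^bsub>fobj M x\<^esub> pact M x m s"
    and restrict_pact: "\<lbrakk>f \<in> Arr C; m \<in> carrier (fobj M (Cod C f)); s \<in> carrier (fobj R (Cod C f))\<rbrakk>
      \<Longrightarrow> fn (farr M f) (pact M (Cod C f) m s)
        = pact M (Dom C f) (fn (farr M f) m) (fn (farr R f) s)"

text \<open>
  Morphisms \<open>M \<rightarrow> N\<close> are the natural transformations with \<open>R(x)\<close>-linear components, made
  extensional so that they are determined by their components at the objects of \<open>C\<close>.
\<close>

definition pmod_hom :: "'k ring \<Rightarrow> ('o, 'c) category \<Rightarrow> ('o, 'c, 'k, 'r) alg_presheaf
    \<Rightarrow> ('o, 'c, 'k, 'r, 'm) pmodule \<Rightarrow> ('o, 'c, 'k, 'r, 'm) pmodule \<Rightarrow> ('o \<Rightarrow> ('k, 'm) kmod_arrow) set"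
  where "pmod_hom k C R M N =
    {T \<in> extensional (Obj C). nat_trans (opposite C) (kmod_category k) M N T \<and>
      (\<forall>x \<in> Obj C. \<forall>m \<in> carrier (fobj M x). \<forall>s \<in> carrier (fobj R x).
        fn (T x) (pact M x m s) = pact N x (fn (T x) m) s)}"

type_synonym ('o, 'c, 'k, 'r, 'm) pmod_arrow =
  "(('o, 'c, 'k, 'r, 'm) pmodule, 'o \<Rightarrow> ('k, 'm) kmod_arrow) arrow"

definition pmod_category :: "'k ring \<Rightarrow> ('o, 'c) category \<Rightarrow> ('o, 'c, 'k, 'r) alg_presheaf
    \<Rightarrow> (('o, 'c, 'k, 'r, 'm) pmodule, ('o, 'c, 'k, 'r, 'm) pmod_arrow) category" where
  "pmod_category k C R = \<lparr>
    Obj = {M. presheaf_module k C R M},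
    Arr = {Arrow M N T | M N T. presheaf_module k C R M \<and> presheaf_module k C R N \<and>
             T \<in> pmod_hom k C R M N},
    Dom = src,
    Cod = trg,
    Id = (\<lambda>M. Arrow M M (\<lambda>x\<in>Obj C. Id (kmod_category k) (fobj M x))),
    Comp = (\<lambda>g f. Arrow (src f) (trg g)
              (\<lambda>x\<in>Obj C. Comp (kmod_category k) (fn g x) (fn f x)))\<rparr>"


section \<open>The skew category algebra\<close>

text \<open>
  The direct sum of the \<open>R(Dom f)\<close> over the arrows \<open>f\<close> of \<open>C\<close>, as a \<open>k\<close>-module of finitely
  supported families. Its multiplicative fields are placeholders.
\<close>

definition skew_module :: "('o, 'c) category \<Rightarrow> ('o, 'c, 'k, 'r) alg_presheaf
    \<Rightarrow> ('k, 'c \<Rightarrow> 'r) module" where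
  "skew_module C R = \<lparr>
    carrier = {u \<in> (\<Pi>\<^sub>E f\<in>Arr C. carrier (fobj R (Dom C f))).
                 finite {f \<in> Arr C. u f \<noteq> \<zero>\<^bsub>fobj R (Dom C f)\<^esub>}},
    monoid.mult = undefined,
    one = undefined,
    zero = (\<lambda>f\<in>Arr C. \<zero>\<^bsub>fobj R (Dom C f)\<^esub>),
    add = (\<lambda>u v. \<lambda>f\<in>Arr C. u f \<oplus>\<^bsub>fobj R (Dom C f)\<^esub> v f),
    smult = (\<lambda>c u. \<lambda>f\<in>Arr C. c \<odot>\<^bsub>fobj R (Dom C f)\<^esub> u f)\<rparr>"

text \<open>The element \<open>rf\<close>.\<close>

definition skew_elem :: "('o, 'c) category \<Rightarrow> ('o, 'c, 'k, 'r) alg_presheaf \<Rightarrow> 'r \<Rightarrow> 'c \<Rightarrow> 'c \<Rightarrow> 'r"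
  where "skew_elem C R r f = (\<lambda>h\<in>Arr C. if h = f then r else \<zero>\<^bsub>fobj R (Dom C h)\<^esub>)"

text \<open>The product \<open>sg * rf\<close>.\<close>

definition skew_elem_mult :: "('o, 'c) category \<Rightarrow> ('o, 'c, 'k, 'r) alg_presheaf
    \<Rightarrow> 'r \<Rightarrow> 'c \<Rightarrow> 'r \<Rightarrow> 'c \<Rightarrow> 'c \<Rightarrow> 'r" where
  "skew_elem_mult C R s g r f =
    (if Dom C g = Cod C f
     then skew_elem C R (fn (farr R f) s \<otimes>\<^bsub>fobj R (Dom C f)\<^esub> r) (Comp C g f)
     else \<zero>\<^bsub>skew_module C R\<^esub>)"

definition skew_support :: "('o, 'c) category \<Rightarrow> ('o, 'c, 'k, 'r) alg_presheaf
    \<Rightarrow> ('c \<Rightarrow> 'r) \<Rightarrow> 'c set" where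
  "skew_support C R u = {f \<in> Arr C. u f \<noteq> \<zero>\<^bsub>fobj R (Dom C f)\<^esub>}"

text \<open>
  The product is the biadditive extension of \<^const>\<open>skew_elem_mult\<close>. The identity is the one for
  finitely many objects (\<^const>\<open>finsum\<close> is a junk value on infinite sets).
\<close>

definition skew_algebra :: "('o, 'c) category \<Rightarrow> ('o, 'c, 'k, 'r) alg_presheaf
    \<Rightarrow> ('k, 'c \<Rightarrow> 'r) module" where
  "skew_algebra C R = (skew_module C R)\<lparr>
    monoid.mult := (\<lambda>u v. \<Oplus>\<^bsub>skew_module C R\<^esub>g\<in>skew_support C R u.
                     \<Oplus>\<^bsub>skew_module C R\<^esub>f\<in>skew_support C R v. skew_elem_mult C R (u g) g (v f) f),
    one := (\<Oplus>\<^bsub>skew_module C R\<^esub>x\<in>Obj C. skew_elem C R \<one>\<^bsub>fobj R x\<^esub> (Id C x))\<rparr>"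

end

theory Submission
  imports Defs
begin

text \<open>
  In the ring \<open>R[C]\<close> the elements \<open>1\<^sub>x = 1 Id\<^sub>x\<close>, for \<open>x\<close> in the finite set of objects, are
  orthogonal idempotents with sum \<open>1\<close>. A right \<open>R[C]\<close>-module \<open>N\<close> is therefore the direct sum of the
  subgroups \<open>N 1\<^sub>x\<close>. On \<open>N 1\<^sub>x\<close> the ring \<open>R(x)\<close> acts through the elements \<open>s Id\<^sub>x\<close>, and for an arrow
  \<open>f : x \<rightarrow> y\<close> right multiplication by \<open>1 f\<close> maps \<open>N 1\<^sub>y\<close> to \<open>N 1\<^sub>x\<close>. The product rule
  \<open>s g * r f = (R(f)(s) r) g f\<close> says exactly that these data form a presheaf of \<open>R\<close>-modules. This
  gives a functor from \<open>R[C]\<close>-modules to presheaves, and the theorem follows once this functor is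
  known to be fully faithful and essentially surjective (\<open>equivalence_of_fully_faithful\<close>).

  It is faithful because a linear map is determined by its restrictions to the summands
  \<open>N 1\<^sub>x\<close>. It is full (\<open>presheaf_functor_full\<close>) because a morphism of presheaves adds up to a map of
  the direct sums, whose linearity can be tested on the factors of
  \<open>r f = (1 Id\<^sub>y) * (1 f) * (r Id\<^sub>x)\<close>: naturality covers \<open>1 f\<close>, linearity over \<open>R(x)\<close> covers \<open>r Id\<^sub>x\<close>.
  It is essentially surjective (\<open>essentially_surjective\<close>) because a presheaf \<open>M\<close> comes from the
  module \<open>\<Oplus>\<^sub>x M(x)\<close>, on which \<open>r f\<close> sends a family \<open>m\<close> to \<open>M(f)(m\<^sub>y) r\<close> placed at \<open>x\<close>. Since the
  objects of the category of modules have their elements in a fixed type, this sum is carried into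
  that type along an injection, which exists because the type is infinite and \<open>C\<close> has finitely many
  objects.

  Everything about \<open>R[C]\<close> rests on its additive group being a direct sum. The product and the module
  actions are additive extensions of their values on the elements \<open>r f\<close> (\<open>additive_extension\<close>), and
  identities that are additive in each argument need checking only on such elements
  (\<open>skew_induct\<close>).
\<close>

section \<open>Categories\<close>

lemma arr_ext: "f = g \<longleftrightarrow> src f = src g \<and> trg f = trg g \<and> fn f = fn g"
  by (cases f; cases g) auto

lemma category_opposite: "category C \<Longrightarrow> category (opposite C)"
  unfolding category_def opposite_def by auto

lemma category_concrete:
  assumes maps: "\<And>A B h. h \<in> H A B \<Longrightarrow> h \<in> car A \<rightarrow> car B"
    and ident: "\<And>A. A \<in> Ob \<Longrightarrow> (\<lambda>a\<in>car A. a) \<in> H A A"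
    and comp: "\<And>A B D g h. \<lbrakk>A \<in> Ob; B \<in> Ob; D \<in> Ob; h \<in> H A B; g \<in> H B D\<rbrakk>
      \<Longrightarrow> compose (car A) g h \<in> H A D"
  shows "category (concrete_category Ob car H)"
proof (unfold_locales, goal_cases)
  case (9 f)
  then show ?case
    using maps by (fastforce simp: concrete_category_def arr_ext compose_def extensional_def fun_eq_iff)
next
  case (10 f)
  then show ?case
    using maps by (fastforce simp: concrete_category_def arr_ext compose_def extensional_def fun_eq_iff)
next
  case (11 h g f)
  then obtain A1 B1 h1 A2 B2 h2 A3 B3 h3 where
    *: "f = Arrow A1 B1 h1" "h1 \<in> H A1 B1" "g = Arrow A2 B2 h2" "h = Arrow A3 B3 h3" "A2 = B1" "A3 = B2"
    by (auto simp: concrete_category_def)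
  show ?case
    using maps[OF *(2)] by (auto simp: concrete_category_def * compose_def fun_eq_iff)
qed (use ident comp in \<open>auto simp: concrete_category_def\<close>)

lemma iso_arrI:
  assumes "f \<in> Arr C" "g \<in> Arr C" "Dom C g = Cod C f" "Cod C g = Dom C f"
    "Comp C g f = Id C (Dom C f)" "Comp C f g = Id C (Cod C f)"
  shows "iso_arr C f"
  using assms unfolding iso_arr_def by blast

lemma cfunctor_id: "category C \<Longrightarrow> cfunctor C C id_func"
  by (simp add: cfunctor_def cfunctor_axioms_def id_func_def)

lemma cfunctor_comp:
  assumes "cfunctor C D F" "cfunctor D E G"
  shows "cfunctor C E (comp_func G F)"
proof -
  interpret F: cfunctor C D F by fact
  interpret G: cfunctor D E G by fact
  show ?thesis
    by unfold_locales
      (simp_all add: comp_func_def F.fobj_closed F.farr_closed F.Dom_farr F.Cod_farr F.farr_Id F.farr_Comp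
        G.fobj_closed G.farr_closed G.Dom_farr G.Cod_farr G.farr_Id G.farr_Comp)
qed

text \<open>
  A quasi-inverse \<open>F\<close> of \<open>G\<close> picks for each object \<open>M\<close> of \<open>C\<close> an object \<open>F M\<close> with an isomorphism
  \<open>e M : M \<rightarrow> G (F M)\<close>. Full faithfulness transports the arrow \<open>e M' \<circ> a \<circ> (e M)\<^sup>-\<^sup>1\<close> back to
  \<open>D\<close>; the counit at \<open>N\<close> is the preimage of \<open>(e (G N))\<^sup>-\<^sup>1\<close>.
\<close>

lemma equivalence_of_fully_faithful:
  fixes C :: "('o, 'a) category" and D :: "('p, 'b) category" and G :: "('p, 'b, 'o, 'a) func"
  assumes "cfunctor D C G"
    and faithful: "\<And>a b. \<lbrakk>a \<in> Arr D; b \<in> Arr D; Dom D a = Dom D b; Cod D a = Cod D b;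
      farr G a = farr G b\<rbrakk> \<Longrightarrow> a = b"
    and full: "\<And>A B c. \<lbrakk>A \<in> Obj D; B \<in> Obj D; c \<in> Arr C; Dom C c = fobj G A; Cod C c = fobj G B\<rbrakk>
      \<Longrightarrow> \<exists>a \<in> Arr D. Dom D a = A \<and> Cod D a = B \<and> farr G a = c"
    and ess_surj: "\<And>M. M \<in> Obj C \<Longrightarrow> \<exists>N \<in> Obj D. \<exists>e. iso_arr C e \<and> Dom C e = M \<and> Cod C e = fobj G N"
  shows "equivalent_categories C D"
proof -
  interpret G: cfunctor D C G by fact
  note DC = G.C.Dom_closed G.C.Cod_closed G.C.Id_closed G.C.Dom_Id G.C.Cod_Id G.C.Comp_closed
    G.C.Dom_Comp G.C.Cod_Comp G.D.Dom_closed G.D.Cod_closed G.D.Id_closed G.D.Dom_Id G.D.Cod_Id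
    G.D.Comp_closed G.D.Dom_Comp G.D.Cod_Comp G.fobj_closed G.farr_closed G.Dom_farr G.Cod_farr
    G.farr_Id G.farr_Comp
  have "\<forall>M. \<exists>N e e'. M \<in> Obj C \<longrightarrow> N \<in> Obj D \<and> e \<in> Arr C \<and> Dom C e = M \<and> Cod C e = fobj G N \<and>
      e' \<in> Arr C \<and> Dom C e' = fobj G N \<and> Cod C e' = M \<and> Comp C e' e = Id C M \<and>
      Comp C e e' = Id C (fobj G N)"
  proof
    fix M
    show "\<exists>N e e'. M \<in> Obj C \<longrightarrow> N \<in> Obj D \<and> e \<in> Arr C \<and> Dom C e = M \<and> Cod C e = fobj G N \<and>
      e' \<in> Arr C \<and> Dom C e' = fobj G N \<and> Cod C e' = M \<and> Comp C e' e = Id C M \<and>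
      Comp C e e' = Id C (fobj G N)"
    proof (cases "M \<in> Obj C")
      case True
      from ess_surj[OF this] obtain N e where N: "N \<in> Obj D" and "iso_arr C e"
        and e: "Dom C e = M" "Cod C e = fobj G N" by blast
      then obtain e' where "e \<in> Arr C" "e' \<in> Arr C" "Dom C e' = fobj G N" "Cod C e' = M"
        "Comp C e' e = Id C M" "Comp C e e' = Id C (fobj G N)"
        unfolding iso_arr_def by auto
      with N e show ?thesis by blast
    qed simp
  qed
  then obtain FO e e' where
    e: "\<And>M. M \<in> Obj C \<Longrightarrow> FO M \<in> Obj D" "\<And>M. M \<in> Obj C \<Longrightarrow> e M \<in> Arr C"
      "\<And>M. M \<in> Obj C \<Longrightarrow> Dom C (e M) = M" "\<And>M. M \<in> Obj C \<Longrightarrow> Cod C (e M) = fobj G (FO M)"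
      "\<And>M. M \<in> Obj C \<Longrightarrow> e' M \<in> Arr C"
      "\<And>M. M \<in> Obj C \<Longrightarrow> Dom C (e' M) = fobj G (FO M)" "\<And>M. M \<in> Obj C \<Longrightarrow> Cod C (e' M) = M"
    and inv: "\<And>M. M \<in> Obj C \<Longrightarrow> Comp C (e' M) (e M) = Id C M"
      "\<And>M. M \<in> Obj C \<Longrightarrow> Comp C (e M) (e' M) = Id C (fobj G (FO M))"
    by (simp only: choice_iff) fastforce
  have cancel: "Comp C (Comp C b (e' M)) (e M) = b"
    if "M \<in> Obj C" "b \<in> Arr C" "Dom C b = M" for b M
    using that G.D.Comp_Id[of b] by (simp add: G.D.Comp_assoc e inv)
  \<comment> \<open>The arrow of \<open>C\<close> that \<open>G (F a)\<close> has to be, if \<open>e\<close> is to be natural.\<close>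
  define conj where "conj a = Comp C (e (Cod C a)) (Comp C a (e' (Dom C a)))" for a
  have conj: "conj a \<in> Arr C" "Dom C (conj a) = fobj G (FO (Dom C a))"
      "Cod C (conj a) = fobj G (FO (Cod C a))"
    if "a \<in> Arr C" for a
    using that by (auto simp: conj_def DC e)
  have "\<forall>a. \<exists>b. a \<in> Arr C \<longrightarrow> b \<in> Arr D \<and> Dom D b = FO (Dom C a) \<and> Cod D b = FO (Cod C a) \<and>
      farr G b = conj a"
    using full conj e(1) DC by metis
  then obtain FA where FA: "\<And>a. a \<in> Arr C \<Longrightarrow> FA a \<in> Arr D" "\<And>a. a \<in> Arr C \<Longrightarrow> Dom D (FA a) = FO (Dom C a)"
      "\<And>a. a \<in> Arr C \<Longrightarrow> Cod D (FA a) = FO (Cod C a)" "\<And>a. a \<in> Arr C \<Longrightarrow> farr G (FA a) = conj a"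
    by metis
  define F where "F = \<lparr>fobj = FO, farr = FA\<rparr>"
  have F_sel: "fobj F = FO" "farr F = FA" by (auto simp: F_def)
  have conj_comp: "conj (Comp C b a) = Comp C (conj b) (conj a)"
    if "b \<in> Arr C" "a \<in> Arr C" "Dom C b = Cod C a" for a b
  proof -
    have "Comp C (conj b) (conj a)
      = Comp C (Comp C (Comp C (e (Cod C b)) b) (e' (Dom C b))) (Comp C (e (Cod C a)) (Comp C a (e' (Dom C a))))"
      using that by (simp add: conj_def DC e G.D.Comp_assoc)
    also have "\<dots> = Comp C (Comp C (Comp C (Comp C (e (Cod C b)) b) (e' (Dom C b))) (e (Cod C a))) (Comp C a (e' (Dom C a)))"
      using that by (simp add: DC e G.D.Comp_assoc[symmetric])
    also have "\<dots> = Comp C (Comp C (e (Cod C b)) b) (Comp C a (e' (Dom C a)))"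
      using that cancel[of "Dom C b" "Comp C (e (Cod C b)) b"] by (simp add: DC e)
    finally show ?thesis using that by (simp add: conj_def DC e G.D.Comp_assoc)
  qed
  have conj_id: "conj (Id C M) = Id C (fobj G (FO M))" if "M \<in> Obj C" for M
  proof -
    have "Comp C (Id C M) (e' M) = e' M" using G.D.Id_Comp[of "e' M"] that by (simp add: e)
    then show ?thesis using that by (simp add: conj_def DC inv)
  qed
  interpret F: cfunctor C D F
    using conj_comp conj_id
    by unfold_locales (auto simp: F_sel FA e DC intro!: faithful)
  have conj_e: "Comp C (conj a) (e (Dom C a)) = Comp C (e (Cod C a)) a" if "a \<in> Arr C" for a
  proof -
    have "conj a = Comp C (Comp C (e (Cod C a)) a) (e' (Dom C a))"
      using that by (simp add: conj_def DC e G.D.Comp_assoc)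
    then show ?thesis
      using that cancel[of "Dom C a" "Comp C (e (Cod C a)) a"] by (simp add: DC e)
  qed
  have unit: "nat_isomorphic C C id_func (comp_func G F)"
    unfolding nat_isomorphic_def
  proof (intro exI conjI ballI)
    have ax: "nat_trans_axioms C C id_func (comp_func G F) e"
      by unfold_locales (simp_all add: id_func_def comp_func_def F_sel FA e conj_e)
    show "nat_trans C C id_func (comp_func G F) e"
      by (intro nat_trans.intro cfunctor_id cfunctor_comp[of C D F C G])
        (fact ax G.D.category_axioms G.cfunctor_axioms F.cfunctor_axioms)+
    show "iso_arr C (e M)" if "M \<in> Obj C" for M
      by (rule iso_arrI[of _ _ "e' M"]) (use that in \<open>auto simp: e inv\<close>)
  qed
  have "\<forall>N\<in>Obj D. \<exists>t\<in>Arr D. Dom D t = FO (fobj G N) \<and> Cod D t = N \<and> farr G t = e' (fobj G N)"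
    by (intro ballI full) (simp_all add: e DC)
  then obtain t where t: "\<And>N. N \<in> Obj D \<Longrightarrow> t N \<in> Arr D"
      "\<And>N. N \<in> Obj D \<Longrightarrow> Dom D (t N) = FO (fobj G N)"
      "\<And>N. N \<in> Obj D \<Longrightarrow> Cod D (t N) = N" "\<And>N. N \<in> Obj D \<Longrightarrow> farr G (t N) = e' (fobj G N)"
    by metis
  have "\<forall>N\<in>Obj D. \<exists>s\<in>Arr D. Dom D s = N \<and> Cod D s = FO (fobj G N) \<and> farr G s = e (fobj G N)"
    by (intro ballI full) (simp_all add: e DC)
  then obtain s where s: "\<And>N. N \<in> Obj D \<Longrightarrow> s N \<in> Arr D" "\<And>N. N \<in> Obj D \<Longrightarrow> Dom D (s N) = N"
      "\<And>N. N \<in> Obj D \<Longrightarrow> Cod D (s N) = FO (fobj G N)" "\<And>N. N \<in> Obj D \<Longrightarrow> farr G (s N) = e (fobj G N)"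
    by metis
  have e'_conj: "Comp C (e' (Cod C a)) (conj a) = Comp C a (e' (Dom C a))" if "a \<in> Arr C" for a
  proof -
    have "Comp C (e' (Cod C a)) (conj a) = Comp C (Comp C (e' (Cod C a)) (e (Cod C a))) (Comp C a (e' (Dom C a)))"
      using that by (simp add: conj_def DC e G.D.Comp_assoc)
    also have "\<dots> = Comp C a (e' (Dom C a))"
      using that G.D.Id_Comp[of "Comp C a (e' (Dom C a))"] by (simp add: DC e inv)
    finally show ?thesis .
  qed
  have counit: "nat_isomorphic D D (comp_func F G) id_func"
    unfolding nat_isomorphic_def
  proof (intro exI conjI ballI)
    have ax: "nat_trans_axioms D D (comp_func F G) id_func t"
    proof (unfold_locales, goal_cases)
      case (4 f)
      then show ?case
        using e'_conj[of "farr G f"]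
        by (intro faithful) (simp_all add: id_func_def comp_func_def F_sel FA e DC conj t)
    qed (simp_all add: id_func_def comp_func_def F_sel e DC t)
    show "nat_trans D D (comp_func F G) id_func t"
      by (intro nat_trans.intro cfunctor_id cfunctor_comp[of D C G D F])
        (fact ax G.C.category_axioms G.cfunctor_axioms F.cfunctor_axioms)+
    show "iso_arr D (t N)" if "N \<in> Obj D" for N
      using that
      by (intro iso_arrI[of _ _ "s N"] faithful) (auto simp: e inv t s DC)
  qed
  show ?thesis
    unfolding equivalent_categories_def
    using F.cfunctor_axioms G.cfunctor_axioms unit counit by blast
qed

section \<open>Additive maps and finite sums\<close>

lemma additive_homD:
  assumes "h \<in> additive_hom M N"
  shows "m \<in> carrier M \<Longrightarrow> h m \<in> carrier N"
    and "m \<in> carrier M \<Longrightarrow> n \<in> carrier M \<Longrightarrow> h (m \<oplus>\<^bsub>M\<^esub> n) = h m \<oplus>\<^bsub>N\<^esub> h n"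
  using assms by (auto simp: additive_hom_def)

lemma additive_hom_zero:
  assumes "abelian_group M" "abelian_group N" "h \<in> additive_hom M N"
  shows "h \<zero>\<^bsub>M\<^esub> = \<zero>\<^bsub>N\<^esub>"
proof -
  interpret M: abelian_group M by fact
  interpret N: abelian_group N by fact
  have "h \<zero>\<^bsub>M\<^esub> \<oplus>\<^bsub>N\<^esub> h \<zero>\<^bsub>M\<^esub> = h \<zero>\<^bsub>M\<^esub>" "h \<zero>\<^bsub>M\<^esub> \<in> carrier N"
    using additive_homD[OF assms(3)] by (metis M.zero_closed M.l_zero, metis M.zero_closed)
  then show ?thesis by (simp add: N.add.l_cancel_one)
qed

lemma additive_hom_finsum:
  assumes "abelian_group M" "abelian_group N" "h \<in> additive_hom M N"
    and "finite I" "g \<in> I \<rightarrow> carrier M"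
  shows "h (finsum M g I) = finsum N (\<lambda>i. h (g i)) I"
proof -
  interpret M: abelian_group M by fact
  interpret N: abelian_group N by fact
  show ?thesis
    using assms(4,5)
  proof (induction I)
    case empty
    then show ?case using additive_hom_zero[OF assms(1-3)] by simp
  next
    case (insert i I)
    moreover from insert have "finsum M g I \<in> carrier M" by (intro M.finsum_closed) auto
    ultimately show ?case using additive_homD[OF assms(3)]
      by (subst M.finsum_insert, simp, simp, force, force, subst N.finsum_insert) (auto simp: Pi_def)
  qed
qed

lemma (in abelian_monoid) finsum_only:
  assumes "finite I" "i \<in> I" "g i \<in> carrier G" "\<And>j. j \<in> I \<Longrightarrow> j \<noteq> i \<Longrightarrow> g j = \<zero>"
  shows "finsum G g I = g i"
proof -
  have "finsum G g {i} = finsum G g I"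
    by (rule add.finprod_mono_neutral_cong_left) (use assms in \<open>auto, metis zero_closed\<close>)
  then show ?thesis using assms(3) by (simp add: finsum_insert)
qed

lemma abelian_group_cong_add_monoid:
  "add_monoid G = add_monoid H \<Longrightarrow> abelian_group G = abelian_group H"
  by (simp add: abelian_group_def abelian_monoid_def abelian_group_axioms_def)

section \<open>The skew category algebra is a ring\<close>

locale skew_setting = C: category C
  for k :: "'k ring" and C :: "('o, 'c) category" and R :: "('o, 'c, 'k, 'r) alg_presheaf" +
  assumes cring: "cring k" and presheaf: "presheaf_of_algebras k C R" and finite_Obj: "finite (Obj C)"
begin

abbreviation "S \<equiv> skew_module C R"
abbreviation "A \<equiv> skew_algebra C R"
abbreviation "E \<equiv> skew_elem C R"
abbreviation "res f \<equiv> fn (farr R f)"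

lemmas C_simps [simp] = C.Dom_closed C.Cod_closed C.Id_closed C.Dom_Id C.Cod_Id C.Comp_closed
  C.Dom_Comp C.Cod_Comp C.Comp_Id C.Id_Comp

lemma R_functor: "cfunctor (opposite C) (alg_category k) R"
  using presheaf by (simp add: presheaf_of_algebras_def)

lemma R_algebra: "x \<in> Obj C \<Longrightarrow> assoc_algebra k (fobj R x)"
  using cfunctor.fobj_closed[OF R_functor, of x]
  by (simp add: alg_category_def concrete_category_def opposite_def)

lemma R_ring: "x \<in> Obj C \<Longrightarrow> ring (fobj R x)"
  using R_algebra assoc_algebra_def by blast

lemma R_group: "x \<in> Obj C \<Longrightarrow> abelian_group (fobj R x)"
  using R_ring ring_def by blast

lemma R_module: "x \<in> Obj C \<Longrightarrow> module k (fobj R x)"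
  using R_algebra assoc_algebra_def by blast

lemma R_closed [simp]:
  assumes "x \<in> Obj C"
  shows "\<zero>\<^bsub>fobj R x\<^esub> \<in> carrier (fobj R x)" "\<one>\<^bsub>fobj R x\<^esub> \<in> carrier (fobj R x)"
    "\<lbrakk>r \<in> carrier (fobj R x); s \<in> carrier (fobj R x)\<rbrakk> \<Longrightarrow> r \<oplus>\<^bsub>fobj R x\<^esub> s \<in> carrier (fobj R x)"
    "\<lbrakk>r \<in> carrier (fobj R x); s \<in> carrier (fobj R x)\<rbrakk> \<Longrightarrow> r \<otimes>\<^bsub>fobj R x\<^esub> s \<in> carrier (fobj R x)"
    "\<lbrakk>c \<in> carrier k; s \<in> carrier (fobj R x)\<rbrakk> \<Longrightarrow> c \<odot>\<^bsub>fobj R x\<^esub> s \<in> carrier (fobj R x)"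
    "r \<in> carrier (fobj R x) \<Longrightarrow> \<zero>\<^bsub>fobj R x\<^esub> \<oplus>\<^bsub>fobj R x\<^esub> r = r"
    "r \<in> carrier (fobj R x) \<Longrightarrow> r \<oplus>\<^bsub>fobj R x\<^esub> \<zero>\<^bsub>fobj R x\<^esub> = r"
    "r \<in> carrier (fobj R x) \<Longrightarrow> \<one>\<^bsub>fobj R x\<^esub> \<otimes>\<^bsub>fobj R x\<^esub> r = r"
    "r \<in> carrier (fobj R x) \<Longrightarrow> r \<otimes>\<^bsub>fobj R x\<^esub> \<one>\<^bsub>fobj R x\<^esub> = r"
  using R_ring[OF assms] R_module[OF assms]
  by (simp_all add: ring.ring_simprules module.smult_closed monoid.r_one ring.is_monoid)

lemma res_hom: "f \<in> Arr C \<Longrightarrow> res f \<in> algebra_hom k (fobj R (Cod C f)) (fobj R (Dom C f))"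
  using cfunctor.farr_closed[OF R_functor, of f] cfunctor.Dom_farr[OF R_functor, of f]
    cfunctor.Cod_farr[OF R_functor, of f]
  by (auto simp: alg_category_def concrete_category_def opposite_def)

lemma res [simp]:
  assumes "f \<in> Arr C" "r \<in> carrier (fobj R (Cod C f))"
  shows "res f r \<in> carrier (fobj R (Dom C f))"
    "s \<in> carrier (fobj R (Cod C f)) \<Longrightarrow>
      res f (r \<oplus>\<^bsub>fobj R (Cod C f)\<^esub> s) = res f r \<oplus>\<^bsub>fobj R (Dom C f)\<^esub> res f s"
    "s \<in> carrier (fobj R (Cod C f)) \<Longrightarrow>
      res f (r \<otimes>\<^bsub>fobj R (Cod C f)\<^esub> s) = res f r \<otimes>\<^bsub>fobj R (Dom C f)\<^esub> res f s"
    "c \<in> carrier k \<Longrightarrow> res f (c \<odot>\<^bsub>fobj R (Cod C f)\<^esub> r) = c \<odot>\<^bsub>fobj R (Dom C f)\<^esub> res f r"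
  using res_hom[OF assms(1)] assms(2) by (auto simp: algebra_hom_def ring_hom_def)

lemma res_one [simp]: "f \<in> Arr C \<Longrightarrow> res f \<one>\<^bsub>fobj R (Cod C f)\<^esub> = \<one>\<^bsub>fobj R (Dom C f)\<^esub>"
  using res_hom[of f] by (auto simp: algebra_hom_def ring_hom_def)

lemma res_Id [simp]: "x \<in> Obj C \<Longrightarrow> r \<in> carrier (fobj R x) \<Longrightarrow> res (Id C x) r = r"
  using cfunctor.farr_Id[OF R_functor, of x]
  by (auto simp: alg_category_def concrete_category_def opposite_def)

lemma res_Comp [simp]:
  assumes "g \<in> Arr C" "f \<in> Arr C" "Dom C g = Cod C f" "r \<in> carrier (fobj R (Cod C g))"
  shows "res (Comp C g f) r = res f (res g r)"
  using cfunctor.farr_Comp[OF R_functor, of f g] cfunctor.Dom_farr[OF R_functor, of g] assms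
  by (auto simp: alg_category_def concrete_category_def opposite_def compose_def)

lemma S_carrier: "u \<in> carrier S \<longleftrightarrow> u \<in> extensional (Arr C)
    \<and> (\<forall>f\<in>Arr C. u f \<in> carrier (fobj R (Dom C f))) \<and> finite (skew_support C R u)"
  by (auto simp: skew_module_def skew_support_def PiE_def Pi_def)

lemma S_add: "u \<oplus>\<^bsub>S\<^esub> v = (\<lambda>f\<in>Arr C. u f \<oplus>\<^bsub>fobj R (Dom C f)\<^esub> v f)"
  and S_zero: "\<zero>\<^bsub>S\<^esub> = (\<lambda>f\<in>Arr C. \<zero>\<^bsub>fobj R (Dom C f)\<^esub>)"
  by (simp_all add: skew_module_def)

lemma support_add:
  "u \<in> carrier S \<Longrightarrow> v \<in> carrier S \<Longrightarrow>
    skew_support C R (u \<oplus>\<^bsub>S\<^esub> v) \<subseteq> skew_support C R u \<union> skew_support C R v"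
  by (auto simp: skew_support_def S_add)

lemma finite_supp: "u \<in> carrier S \<Longrightarrow> finite (skew_support C R u)"
  by (simp add: S_carrier)

lemma supp_subset: "skew_support C R u \<subseteq> Arr C"
  by (auto simp: skew_support_def)

lemma S_group: "abelian_group S"
proof (rule abelian_groupI, goal_cases)
  case (1 u v)
  then show ?case
    using finite_subset[OF support_add[OF 1]] by (simp add: S_carrier) (simp add: S_add)
next
  case 2
  then show ?case by (simp add: S_carrier skew_support_def S_zero)
next
  case (3 u v w)
  then show ?case
    by (auto simp: S_carrier S_add fun_eq_iff abelian_monoid.a_assoc[OF abelian_group.axioms(1)[OF R_group]])
next
  case (4 u v)
  then show ?case
    by (auto simp: S_carrier S_add fun_eq_iff abelian_monoid.a_comm[OF abelian_group.axioms(1)[OF R_group]])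
next
  case (5 u)
  then show ?case by (auto simp: S_carrier S_add S_zero fun_eq_iff extensional_def)
next
  case (6 u)
  let ?v = "\<lambda>f\<in>Arr C. \<ominus>\<^bsub>fobj R (Dom C f)\<^esub> u f"
  have "skew_support C R ?v \<subseteq> skew_support C R u"
    by (auto simp: skew_support_def abelian_group.a_inv_closed[OF R_group] S_carrier
        ring.minus_zero[OF R_ring])
  with 6 have "?v \<in> carrier S"
    by (auto simp: S_carrier abelian_group.a_inv_closed[OF R_group] dest: finite_subset)
  moreover have "?v \<oplus>\<^bsub>S\<^esub> u = \<zero>\<^bsub>S\<^esub>"
    using 6 by (auto simp: S_carrier S_add S_zero fun_eq_iff abelian_group.l_neg[OF R_group])
  ultimately show ?case by blast
qed

lemma E_closed [simp]: "f \<in> Arr C \<Longrightarrow> r \<in> carrier (fobj R (Dom C f)) \<Longrightarrow> E r f \<in> carrier S"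
  by (auto simp: S_carrier skew_elem_def skew_support_def intro!: finite_subset[of _ "{f}"])

lemma E_additive: "f \<in> Arr C \<Longrightarrow> (\<lambda>r. E r f) \<in> additive_hom (fobj R (Dom C f)) S"
  by (auto simp: additive_hom_def) (auto simp: skew_elem_def S_add fun_eq_iff)

text \<open>
  Splitting off the coefficient at one arrow of the support reduces an element of \<open>R[C]\<close> to a
  smaller support. The rule reduces additive identities to the elements \<open>r f\<close>.
\<close>

lemma skew_induct [consumes 1, case_names zero add elem]:
  assumes "u \<in> carrier S"
    and zero: "P \<zero>\<^bsub>S\<^esub>"
    and add: "\<And>u v. \<lbrakk>u \<in> carrier S; v \<in> carrier S; P u; P v\<rbrakk> \<Longrightarrow> P (u \<oplus>\<^bsub>S\<^esub> v)"
    and elem: "\<And>f r. \<lbrakk>f \<in> Arr C; r \<in> carrier (fobj R (Dom C f))\<rbrakk> \<Longrightarrow> P (E r f)"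
  shows "P u"
proof -
  have "P u" if "finite B" "skew_support C R u \<subseteq> B" "u \<in> carrier S" for B u
    using that
  proof (induction B arbitrary: u)
    case empty
    then have "u = \<zero>\<^bsub>S\<^esub>"
      by (auto simp: skew_support_def S_carrier S_zero fun_eq_iff extensional_def)
    then show ?case using zero by simp
  next
    case (insert f B)
    show ?case
    proof (cases "f \<in> Arr C")
      case True
      define v where "v = (\<lambda>h\<in>Arr C. if h = f then \<zero>\<^bsub>fobj R (Dom C h)\<^esub> else u h)"
      have supp: "skew_support C R v \<subseteq> B" "skew_support C R v \<subseteq> skew_support C R u"
        using insert.prems by (auto simp: skew_support_def v_def)
      then have v: "v \<in> carrier S"
        using insert.prems finite_subset[OF supp(2)] by (auto simp: S_carrier v_def)
      have "u = E (u f) f \<oplus>\<^bsub>S\<^esub> v"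
        using insert.prems True
        by (auto simp: v_def skew_elem_def S_add S_carrier fun_eq_iff extensional_def)
      moreover have "u f \<in> carrier (fobj R (Dom C f))"
        using insert.prems True by (simp add: S_carrier)
      ultimately show ?thesis
        using add[of "E (u f) f" v] insert.IH[OF supp(1) v] True elem v by auto
    next
      case False
      then show ?thesis using insert supp_subset[of u] by (metis subset_insert subsetD)
    qed
  qed
  then show ?thesis using assms(1) finite_supp by blast
qed

text \<open>
  The homomorphism out of the direct sum \<open>\<Oplus>\<^sub>f R(dom f)\<close> with components \<open>\<phi> f\<close>.
\<close>

definition additive_extension :: "('g, 'z) ring_scheme \<Rightarrow> ('c \<Rightarrow> 'r \<Rightarrow> 'g) \<Rightarrow> ('c \<Rightarrow> 'r) \<Rightarrow> 'g" where
  "additive_extension G \<phi> u = finsum G (\<lambda>f. \<phi> f (u f)) (skew_support C R u)"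

text \<open>
  The supports of \<open>u\<close>, \<open>v\<close> and \<open>u + v\<close> differ, so the three sums are compared over one finite
  set containing all of them; the added terms vanish as \<open>\<phi> f 0 = 0\<close>.
\<close>

lemma
  assumes G: "abelian_group G"
    and \<phi>: "\<And>f. f \<in> Arr C \<Longrightarrow> \<phi> f \<in> additive_hom (fobj R (Dom C f)) G"
  shows additive_extension: "additive_extension G \<phi> \<in> additive_hom S G"
    and additive_extension_elem:
      "f \<in> Arr C \<Longrightarrow> r \<in> carrier (fobj R (Dom C f)) \<Longrightarrow> additive_extension G \<phi> (E r f) = \<phi> f r"
proof -
  interpret G: abelian_group G by fact
  have zero: "\<phi> f \<zero>\<^bsub>fobj R (Dom C f)\<^esub> = \<zero>\<^bsub>G\<^esub>" if "f \<in> Arr C" for f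
    using additive_hom_zero[OF R_group G \<phi>] that by auto
  have closed: "(\<lambda>f. \<phi> f (u f)) \<in> B \<rightarrow> carrier G" if "u \<in> carrier S" "B \<subseteq> Arr C" for u B
    using additive_homD(1)[OF \<phi>] that by (auto simp: S_carrier)
  have larger: "additive_extension G \<phi> u = finsum G (\<lambda>f. \<phi> f (u f)) B"
    if "u \<in> carrier S" "finite B" "skew_support C R u \<subseteq> B" "B \<subseteq> Arr C" for u B
    unfolding additive_extension_def
    by (rule G.add.finprod_mono_neutral_cong_left)
      (use that closed in \<open>auto simp: skew_support_def zero\<close>)
  have "additive_extension G \<phi> (u \<oplus>\<^bsub>S\<^esub> v) = additive_extension G \<phi> u \<oplus>\<^bsub>G\<^esub> additive_extension G \<phi> v"
    if u: "u \<in> carrier S" and v: "v \<in> carrier S" for u v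
  proof -
    let ?B = "skew_support C R u \<union> skew_support C R v"
    have B: "finite ?B" "?B \<subseteq> Arr C" using finite_supp u v supp_subset by auto
    have "additive_extension G \<phi> (u \<oplus>\<^bsub>S\<^esub> v) = finsum G (\<lambda>f. \<phi> f ((u \<oplus>\<^bsub>S\<^esub> v) f)) ?B"
      using larger[OF _ B(1) support_add[OF u v] B(2)] abelian_monoid.a_closed[OF abelian_group.axioms(1)[OF S_group]] u v by blast
    also have "\<dots> = finsum G (\<lambda>f. \<phi> f (u f) \<oplus>\<^bsub>G\<^esub> \<phi> f (v f)) ?B"
      using closed[OF u B(2)] closed[OF v B(2)] B u v
      by (intro G.finsum_cong') (auto simp: S_add S_carrier additive_homD(2)[OF \<phi>] subset_iff)
    also have "\<dots> = additive_extension G \<phi> u \<oplus>\<^bsub>G\<^esub> additive_extension G \<phi> v"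
      using closed[OF u B(2)] closed[OF v B(2)] B u v
      by (simp only: G.finsum_addf larger[OF u B(1) Un_upper1 B(2)] larger[OF v B(1) Un_upper2 B(2)])
    finally show ?thesis .
  qed
  then show "additive_extension G \<phi> \<in> additive_hom S G"
    using closed[OF _ supp_subset] by (auto simp: additive_hom_def additive_extension_def intro!: G.finsum_closed)
  show "additive_extension G \<phi> (E r f) = \<phi> f r" if "f \<in> Arr C" "r \<in> carrier (fobj R (Dom C f))"
  proof -
    have "additive_extension G \<phi> (E r f) = finsum G (\<lambda>h. \<phi> h (E r f h)) {f}"
      using that E_closed[OF that] by (intro larger) (auto simp: skew_support_def, simp add: skew_elem_def split: if_splits)
    also have "\<dots> = \<phi> f r"
      using that additive_homD(1)[OF \<phi>] by (subst G.finsum_only[of _ f]) (auto simp: skew_elem_def)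
    finally show ?thesis .
  qed
qed

text \<open>
  For fixed \<open>v\<close> the sum runs over the fixed support of \<open>v\<close>, so additivity in a parameter holds term
  by term. With the preceding lemma this makes products and actions additive in both arguments.
\<close>

lemma additive_extension_param:
  assumes G: "abelian_group G" and v: "v \<in> carrier S"
    and \<phi>: "\<And>f r. f \<in> Arr C \<Longrightarrow> r \<in> carrier (fobj R (Dom C f)) \<Longrightarrow> (\<lambda>b. \<phi> b f r) \<in> additive_hom B G"
  shows "(\<lambda>b. additive_extension G (\<phi> b) v) \<in> additive_hom B G"
proof -
  interpret G: abelian_group G by fact
  have closed: "(\<lambda>f. \<phi> b f (v f)) \<in> skew_support C R v \<rightarrow> carrier G" if "b \<in> carrier B" for b
    using additive_homD(1)[OF \<phi>] that v by (auto simp: S_carrier skew_support_def)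
  have "additive_extension G (\<phi> (a \<oplus>\<^bsub>B\<^esub> b)) v
      = finsum G (\<lambda>f. \<phi> a f (v f) \<oplus>\<^bsub>G\<^esub> \<phi> b f (v f)) (skew_support C R v)"
    if "a \<in> carrier B" "b \<in> carrier B" for a b
    unfolding additive_extension_def
    using closed[OF that(1)] closed[OF that(2)] additive_homD(2)[OF \<phi>] that v
    by (intro G.finsum_cong') (auto simp: S_carrier skew_support_def)
  then show ?thesis
    using closed by (simp add: additive_hom_def additive_extension_def G.finsum_addf)
qed

lemma A_sel [simp]: "carrier A = carrier S" "add A = add S" "zero A = zero S"
    "one A = (\<Oplus>\<^bsub>S\<^esub>x\<in>Obj C. E \<one>\<^bsub>fobj R x\<^esub> (Id C x))"
  by (simp_all add: skew_algebra_def)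

lemma A_mult: "u \<otimes>\<^bsub>A\<^esub> v =
    additive_extension S (\<lambda>g s. additive_extension S (\<lambda>f r. skew_elem_mult C R s g r f) v) u"
  by (simp add: skew_algebra_def additive_extension_def)

lemma add_monoid_A: "add_monoid A = add_monoid S"
  by simp

lemma A_group: "abelian_group A"
  using abelian_group_cong_add_monoid[OF add_monoid_A] S_group by simp

lemma elem_mult_additive_r:
  assumes "g \<in> Arr C" "s \<in> carrier (fobj R (Dom C g))" "f \<in> Arr C"
  shows "(\<lambda>r. skew_elem_mult C R s g r f) \<in> additive_hom (fobj R (Dom C f)) S"
proof (cases "Dom C g = Cod C f")
  case True
  interpret ring "fobj R (Dom C f)" using assms by (simp add: R_ring)
  show ?thesis
    using True assms additive_homD[OF E_additive[of "Comp C g f"]]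
    by (simp add: additive_hom_def skew_elem_mult_def r_distr)
next
  case False
  then show ?thesis using S_group abelian_group.axioms(1) abelian_monoid.zero_closed abelian_monoid.l_zero
    by (fastforce simp: additive_hom_def skew_elem_mult_def)
qed

lemma elem_mult_additive_l:
  assumes "g \<in> Arr C" "f \<in> Arr C" "r \<in> carrier (fobj R (Dom C f))"
  shows "(\<lambda>s. skew_elem_mult C R s g r f) \<in> additive_hom (fobj R (Dom C g)) S"
proof (cases "Dom C g = Cod C f")
  case True
  interpret ring "fobj R (Dom C f)" using assms by (simp add: R_ring)
  show ?thesis
    using True assms additive_homD[OF E_additive[of "Comp C g f"]]
    by (simp add: additive_hom_def skew_elem_mult_def l_distr)
next
  case False
  then show ?thesis using S_group abelian_group.axioms(1) abelian_monoid.zero_closed abelian_monoid.l_zero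
    by (fastforce simp: additive_hom_def skew_elem_mult_def)
qed

lemma inner_additive:
  "\<lbrakk>v \<in> carrier S; g \<in> Arr C\<rbrakk> \<Longrightarrow> (\<lambda>s. additive_extension S (\<lambda>f r. skew_elem_mult C R s g r f) v)
    \<in> additive_hom (fobj R (Dom C g)) S"
  by (rule additive_extension_param[OF S_group]) (auto intro: elem_mult_additive_l)

lemma mult_additive_l: "v \<in> carrier S \<Longrightarrow> (\<lambda>u. u \<otimes>\<^bsub>A\<^esub> v) \<in> additive_hom S S"
  unfolding A_mult by (rule additive_extension[OF S_group inner_additive, unfolded eta_contract_eq])

lemma mult_additive_r: "u \<in> carrier S \<Longrightarrow> (\<lambda>v. u \<otimes>\<^bsub>A\<^esub> v) \<in> additive_hom S S"
  unfolding A_mult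
  by (rule additive_extension_param[OF S_group])
    (auto intro: additive_extension[OF S_group elem_mult_additive_r])

lemma E_mult:
  assumes "g \<in> Arr C" "s \<in> carrier (fobj R (Dom C g))" "f \<in> Arr C" "r \<in> carrier (fobj R (Dom C f))"
  shows "E s g \<otimes>\<^bsub>A\<^esub> E r f =
    (if Dom C g = Cod C f then E (res f s \<otimes>\<^bsub>fobj R (Dom C f)\<^esub> r) (Comp C g f) else \<zero>\<^bsub>S\<^esub>)"
  unfolding A_mult using assms
  by (subst additive_extension_elem[OF S_group inner_additive])
    (auto simp: additive_extension_elem[OF S_group elem_mult_additive_r], simp_all add: skew_elem_mult_def)

lemma A_zero_mult:
  "v \<in> carrier S \<Longrightarrow> \<zero>\<^bsub>S\<^esub> \<otimes>\<^bsub>A\<^esub> v = \<zero>\<^bsub>S\<^esub>" "v \<in> carrier S \<Longrightarrow> v \<otimes>\<^bsub>A\<^esub> \<zero>\<^bsub>S\<^esub> = \<zero>\<^bsub>S\<^esub>"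
  using additive_hom_zero[OF S_group S_group mult_additive_l]
    additive_hom_zero[OF S_group S_group mult_additive_r] by auto

lemma S_closed [simp]: "\<zero>\<^bsub>S\<^esub> \<in> carrier S" "\<lbrakk>u \<in> carrier S; v \<in> carrier S\<rbrakk> \<Longrightarrow> u \<oplus>\<^bsub>S\<^esub> v \<in> carrier S"
  using S_group by (simp_all add: abelian_group.axioms(1) abelian_monoid.zero_closed abelian_monoid.a_closed)

lemma mult_closed [simp]: "\<lbrakk>u \<in> carrier S; v \<in> carrier S\<rbrakk> \<Longrightarrow> u \<otimes>\<^bsub>A\<^esub> v \<in> carrier S"
  by (rule additive_homD(1)[OF mult_additive_r])

lemma mult_add:
  assumes "u \<in> carrier S" "v \<in> carrier S" "w \<in> carrier S"
  shows "(u \<oplus>\<^bsub>S\<^esub> v) \<otimes>\<^bsub>A\<^esub> w = u \<otimes>\<^bsub>A\<^esub> w \<oplus>\<^bsub>S\<^esub> v \<otimes>\<^bsub>A\<^esub> w"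
    "u \<otimes>\<^bsub>A\<^esub> (v \<oplus>\<^bsub>S\<^esub> w) = u \<otimes>\<^bsub>A\<^esub> v \<oplus>\<^bsub>S\<^esub> u \<otimes>\<^bsub>A\<^esub> w"
  using assms additive_homD(2)[OF mult_additive_l[of w], of u v]
    additive_homD(2)[OF mult_additive_r[of u], of v w] by auto

text \<open>
  If all arrows are composable, both sides are \<open>(R(g f)(t) R(f)(s) r) h g f\<close>, since \<open>R(f)\<close> is
  multiplicative and \<open>R(g f) = R(f) \<circ> R(g)\<close>; otherwise both vanish.
\<close>

lemma E_assoc:
  assumes "h \<in> Arr C" "t \<in> carrier (fobj R (Dom C h))" "g \<in> Arr C" "s \<in> carrier (fobj R (Dom C g))"
    "f \<in> Arr C" "r \<in> carrier (fobj R (Dom C f))"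
  shows "E t h \<otimes>\<^bsub>A\<^esub> E s g \<otimes>\<^bsub>A\<^esub> E r f = E t h \<otimes>\<^bsub>A\<^esub> (E s g \<otimes>\<^bsub>A\<^esub> E r f)"
proof (cases "Dom C h = Cod C g \<and> Dom C g = Cod C f")
  case True
  interpret ring "fobj R (Dom C f)" using assms by (simp add: R_ring)
  show ?thesis
    using True assms res(1)[of g t] res(1)[of f s] res(1)[of f "res g t"]
    by (simp add: E_mult C.Comp_assoc m_assoc)
next
  case False
  then show ?thesis
    using assms by (auto simp: E_mult A_zero_mult)
qed

lemma mult_assoc:
  assumes "u \<in> carrier S" "v \<in> carrier S" "w \<in> carrier S"
  shows "u \<otimes>\<^bsub>A\<^esub> v \<otimes>\<^bsub>A\<^esub> w = u \<otimes>\<^bsub>A\<^esub> (v \<otimes>\<^bsub>A\<^esub> w)"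
  using assms
proof (induction u rule: skew_induct)
  case (elem h t)
  from elem(3,4) show ?case
  proof (induction v rule: skew_induct)
    case (elem g s)
    from elem(3) show ?case
    proof (induction w rule: skew_induct)
      case (elem f r)
      then show ?case using E_assoc \<open>h \<in> Arr C\<close> \<open>g \<in> Arr C\<close>
        \<open>t \<in> carrier (fobj R (Dom C h))\<close> \<open>s \<in> carrier (fobj R (Dom C g))\<close> by blast
    qed (use elem \<open>h \<in> Arr C\<close> \<open>t \<in> carrier (fobj R (Dom C h))\<close> in \<open>simp_all add: A_zero_mult mult_add\<close>)
  qed (use elem in \<open>simp_all add: A_zero_mult mult_add\<close>)
qed (simp_all add: A_zero_mult mult_add)

lemma E_Id_mult [simp]:
  assumes "x \<in> Obj C" "s \<in> carrier (fobj R x)" "f \<in> Arr C" "r \<in> carrier (fobj R (Dom C f))"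
  shows "E s (Id C x) \<otimes>\<^bsub>A\<^esub> E r f = (if Cod C f = x then E (res f s \<otimes>\<^bsub>fobj R (Dom C f)\<^esub> r) f else \<zero>\<^bsub>S\<^esub>)"
    "E r f \<otimes>\<^bsub>A\<^esub> E s (Id C x) = (if Dom C f = x then E (r \<otimes>\<^bsub>fobj R x\<^esub> s) f else \<zero>\<^bsub>S\<^esub>)"
  using assms by (auto simp: E_mult)

lemma one_closed: "\<one>\<^bsub>A\<^esub> \<in> carrier S"
  by (auto intro!: abelian_monoid.finsum_closed[OF abelian_group.axioms(1)[OF S_group]])

text \<open>
  Of the summands \<open>1 Id\<^sub>x\<close> of the identity only the one at the codomain of \<open>f\<close> acts on \<open>r f\<close> from the
  left, and only the one at its domain from the right; both fix \<open>r f\<close>.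
\<close>

lemma A_ring: "ring A"
proof (rule ringI)
  show "abelian_group A" by (rule A_group)
  have l: "\<one>\<^bsub>A\<^esub> \<otimes>\<^bsub>A\<^esub> u = u" if "u \<in> carrier S" for u
    using that
  proof (induction u rule: skew_induct)
    case (elem f r)
    have "\<one>\<^bsub>A\<^esub> \<otimes>\<^bsub>A\<^esub> E r f = (\<Oplus>\<^bsub>S\<^esub>x\<in>Obj C. E \<one>\<^bsub>fobj R x\<^esub> (Id C x) \<otimes>\<^bsub>A\<^esub> E r f)"
      using elem finite_Obj by (simp add: additive_hom_finsum[OF S_group S_group mult_additive_l])
    also have "\<dots> = E r f"
      using elem finite_Obj
      by (subst abelian_monoid.finsum_only[OF abelian_group.axioms(1)[OF S_group], of _ "Cod C f"]) auto
    finally show ?case .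
  qed (use one_closed in \<open>simp_all only: A_zero_mult mult_add\<close>)
  have r: "u \<otimes>\<^bsub>A\<^esub> \<one>\<^bsub>A\<^esub> = u" if "u \<in> carrier S" for u
    using that
  proof (induction u rule: skew_induct)
    case (elem f r)
    have "E r f \<otimes>\<^bsub>A\<^esub> \<one>\<^bsub>A\<^esub> = (\<Oplus>\<^bsub>S\<^esub>x\<in>Obj C. E r f \<otimes>\<^bsub>A\<^esub> E \<one>\<^bsub>fobj R x\<^esub> (Id C x))"
      using elem finite_Obj by (simp add: additive_hom_finsum[OF S_group S_group mult_additive_r])
    also have "\<dots> = E r f"
      using elem finite_Obj
      by (subst abelian_monoid.finsum_only[OF abelian_group.axioms(1)[OF S_group], of _ "Dom C f"]) auto
    finally show ?case .
  qed (use one_closed in \<open>simp_all only: A_zero_mult mult_add\<close>)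
  show "monoid A"
    by (rule monoidI) (use one_closed l r mult_assoc in \<open>simp_all del: A_sel(4)\<close>)
qed (simp_all add: mult_add)

end

section \<open>Categories of modules\<close>

lemma additive_hom_ident: "(\<lambda>a\<in>carrier M. a) \<in> additive_hom M M" if "abelian_group M"
  using that abelian_group.axioms(1) abelian_monoid.a_closed by (fastforce simp: additive_hom_def)

lemma additive_hom_compose:
  assumes "abelian_group L" "h \<in> additive_hom L M" "g \<in> additive_hom M N"
  shows "compose (carrier L) g h \<in> additive_hom L N"
  using assms(2,3) abelian_monoid.a_closed[OF abelian_group.axioms(1)[OF assms(1)]]
  by (auto simp: additive_hom_def compose_def Pi_def)

lemma category_rmod:
  fixes A :: "('r, 'y) ring_scheme"
  shows "category (rmod_category A :: (('r, 'm) rmodule, ('r, 'm) rmod_arrow) category)"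
  unfolding rmod_category_def
proof (rule category_concrete)
  fix L M N :: "('r, 'm) rmodule" and g h
  assume "L \<in> {M. right_module A M (ract M)}" "h \<in> rmod_hom A L M" "g \<in> rmod_hom A M N"
  then show "compose (carrier L) g h \<in> rmod_hom A L N"
    using additive_hom_compose[of L h M g N] right_module.act_closed[of A L "ract L"]
    by (auto simp: rmod_hom_def right_module_def compose_def dest: additive_homD(1))
next
  fix M :: "('r, 'm) rmodule"
  assume "M \<in> {M. right_module A M (ract M)}"
  then show "(\<lambda>a\<in>carrier M. a) \<in> rmod_hom A M M"
    using additive_hom_ident[of M] right_module.act_closed[of A M "ract M"]
    by (auto simp: rmod_hom_def right_module_def)
qed (auto simp: rmod_hom_def additive_hom_def)

lemma category_kmod:
  fixes k :: "'k ring"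
  shows "category (kmod_category k :: (('k, 'm) module, ('k, 'm) kmod_arrow) category)"
  unfolding kmod_category_def
proof (rule category_concrete)
  fix L M N :: "('k, 'm) module" and g h
  assume "L \<in> {M. module k M}" "h \<in> kmod_hom k L M" "g \<in> kmod_hom k M N"
  then show "compose (carrier L) g h \<in> kmod_hom k L N"
    using additive_hom_compose[of L h M g N] module.smult_closed[of k L]
    by (auto simp: kmod_hom_def module_def compose_def dest: additive_homD(1))
next
  fix M :: "('k, 'm) module"
  assume "M \<in> {M. module k M}"
  then show "(\<lambda>a\<in>carrier M. a) \<in> kmod_hom k M M"
    using additive_hom_ident[of M] module.smult_closed[of k M]
    by (auto simp: kmod_hom_def module_def)
qed (auto simp: kmod_hom_def additive_hom_def)

lemma kmod_sel:
  "Obj (kmod_category k) = {M. module k M}"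
  "Arr (kmod_category k) = {Arrow M N h | M N h. module k M \<and> module k N \<and>
     h \<in> kmod_hom k M N \<and> h \<in> extensional (carrier M)}"
  "Dom (kmod_category k) = src" "Cod (kmod_category k) = trg"
  "Id (kmod_category k) = (\<lambda>M. Arrow M M (\<lambda>m\<in>carrier M. m))"
  "Comp (kmod_category k) g f = Arrow (src f) (trg g) (compose (carrier (src f)) (fn g) (fn f))"
  by (auto simp: kmod_category_def concrete_category_def)

lemma rmod_sel:
  "Obj (rmod_category A) = {M. right_module A M (ract M)}"
  "Arr (rmod_category A) = {Arrow M N h | M N h. right_module A M (ract M) \<and> right_module A N (ract N) \<and>
     h \<in> rmod_hom A M N \<and> h \<in> extensional (carrier M)}"
  "Dom (rmod_category A) = src" "Cod (rmod_category A) = trg"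
  "Id (rmod_category A) = (\<lambda>M. Arrow M M (\<lambda>m\<in>carrier M. m))"
  "Comp (rmod_category A) g f = Arrow (src f) (trg g) (compose (carrier (src f)) (fn g) (fn f))"
  by (auto simp: rmod_category_def concrete_category_def)

lemma pmod_sel:
  "Obj (pmod_category k C R) = {M. presheaf_module k C R M}"
  "Arr (pmod_category k C R) = {Arrow M N T | M N T. presheaf_module k C R M \<and> presheaf_module k C R N \<and>
     T \<in> pmod_hom k C R M N}"
  "Dom (pmod_category k C R) = src" "Cod (pmod_category k C R) = trg"
  "Id (pmod_category k C R) = (\<lambda>M. Arrow M M (\<lambda>x\<in>Obj C. Id (kmod_category k) (fobj M x)))"
  "Comp (pmod_category k C R) g f = Arrow (src f) (trg g)
     (\<lambda>x\<in>Obj C. Comp (kmod_category k) (fn g x) (fn f x))"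
  by (auto simp: pmod_category_def)

text \<open>
  Arrows of modules are extensional functions, so a naturality square of arrows amounts to an
  identity between values. All later constructions of morphisms of presheaves go through this form.
\<close>

lemma pmod_hom_iff:
  assumes "presheaf_module k C R M" "presheaf_module k C R N"
  shows "T \<in> pmod_hom k C R M N \<longleftrightarrow> T \<in> extensional (Obj C) \<and>
    (\<forall>x\<in>Obj C. src (T x) = fobj M x \<and> trg (T x) = fobj N x \<and>
      fn (T x) \<in> kmod_hom k (fobj M x) (fobj N x) \<and> fn (T x) \<in> extensional (carrier (fobj M x))) \<and>
    (\<forall>f\<in>Arr C. \<forall>m\<in>carrier (fobj M (Cod C f)).
      fn (farr N f) (fn (T (Cod C f)) m) = fn (T (Dom C f)) (fn (farr M f) m)) \<and>
    (\<forall>x\<in>Obj C. \<forall>m\<in>carrier (fobj M x). \<forall>s\<in>carrier (fobj R x).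
      fn (T x) (pact M x m s) = pact N x (fn (T x) m) s)" (is "_ \<longleftrightarrow> ?ext \<and> ?maps \<and> ?nat \<and> ?lin")
proof -
  interpret M: presheaf_module k C R M by fact
  interpret N: presheaf_module k C R N by fact
  have obj: "module k (fobj M x)" "module k (fobj N x)" if "x \<in> Obj C" for x
    using M.M.fobj_closed N.M.fobj_closed that by (auto simp: kmod_sel opposite_def)
  have ends: "src (farr M f) = fobj M (Cod C f)" "trg (farr M f) = fobj M (Dom C f)"
    "src (farr N f) = fobj N (Cod C f)" "trg (farr N f) = fobj N (Dom C f)" if "f \<in> Arr C" for f
    using M.M.Dom_farr[of f] M.M.Cod_farr[of f] N.M.Dom_farr[of f] N.M.Cod_farr[of f] that
    by (auto simp: kmod_sel opposite_def)
  have *: "nat_trans (opposite C) (kmod_category k) M N T \<longleftrightarrow>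
      nat_trans_axioms (opposite C) (kmod_category k) M N T"
    using M.M.cfunctor_axioms N.M.cfunctor_axioms by (simp add: nat_trans_def)
  have maps: "(\<forall>x\<in>Obj C. T x \<in> Arr (kmod_category k) \<and> src (T x) = fobj M x \<and> trg (T x) = fobj N x) \<longleftrightarrow> ?maps"
    using obj by (auto simp: kmod_sel) (metis arrow.collapse)
  have nat: "?maps \<Longrightarrow> (\<forall>f\<in>Arr C. Comp (kmod_category k) (farr N f) (T (Cod C f))
       = Comp (kmod_category k) (T (Dom C f)) (farr M f)) \<longleftrightarrow> ?nat"
    using M.M.C.Dom_closed M.M.C.Cod_closed
    by (auto simp: kmod_sel ends opposite_def compose_def fun_eq_iff)
  have "nat_trans_axioms (opposite C) (kmod_category k) M N T \<longleftrightarrow> ?maps \<and> ?nat"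
    unfolding maps[symmetric] using nat unfolding maps[symmetric]
    by (auto simp: nat_trans_axioms_def opposite_def kmod_sel(3,4))
  then show ?thesis by (simp only: pmod_hom_def mem_Collect_eq *) blast
qed

lemma pmod_homD:
  assumes "presheaf_module k C R M" "presheaf_module k C R N" "T \<in> pmod_hom k C R M N" "x \<in> Obj C"
  shows "T x = Arrow (fobj M x) (fobj N x) (fn (T x))"
    "fn (T x) \<in> additive_hom (fobj M x) (fobj N x)"
    "fn (T x) \<in> extensional (carrier (fobj M x))"
    "m \<in> carrier (fobj M x) \<Longrightarrow> fn (T x) m \<in> carrier (fobj N x)"
    "m \<in> carrier (fobj M x) \<Longrightarrow> s \<in> carrier (fobj R x) \<Longrightarrow> fn (T x) (pact M x m s) = pact N x (fn (T x) m) s"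
  using assms(3,4) unfolding pmod_hom_iff[OF assms(1,2)]
  by (auto simp: kmod_hom_def additive_hom_def arr_ext)

lemma restrict_kmod_hom:
  "module k M \<Longrightarrow> restrict h (carrier M) \<in> kmod_hom k M N \<longleftrightarrow> h \<in> kmod_hom k M N"
  using module.smult_closed[of k M] abelian_monoid.a_closed[OF abelian_group.axioms(1), of M]
  by (auto simp: kmod_hom_def additive_hom_def module_def Pi_def)

lemma restrict_rmod_hom:
  "right_module A M (ract M) \<Longrightarrow> restrict h (carrier M) \<in> rmod_hom A M N \<longleftrightarrow> h \<in> rmod_hom A M N"
  using right_module.act_closed[of A M "ract M"] abelian_monoid.a_closed[OF abelian_group.axioms(1), of M]
  by (auto simp: rmod_hom_def additive_hom_def right_module_def Pi_def)

lemma Arrow_in_kmod: "Arrow M N h \<in> Arr (kmod_category k) \<longleftrightarrow> module k M \<and> module k N \<and>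
     h \<in> kmod_hom k M N \<and> h \<in> extensional (carrier M)"
  by (auto simp: kmod_sel)

context skew_setting
begin

lemma presheaf_module_obj:
  assumes "presheaf_module k C R M" "x \<in> Obj C"
  shows "module k (fobj M x)" "abelian_group (fobj M x)" "right_module (fobj R x) (fobj M x) (pact M x)"
    "\<lbrakk>m \<in> carrier (fobj M x); s \<in> carrier (fobj R x)\<rbrakk> \<Longrightarrow> pact M x m s \<in> carrier (fobj M x)"
proof -
  interpret M: presheaf_module k C R M by fact
  show "module k (fobj M x)"
    using M.M.fobj_closed assms(2) by (auto simp: kmod_sel opposite_def)
  then show "abelian_group (fobj M x)" by (simp add: module_def)
  show "right_module (fobj R x) (fobj M x) (pact M x)" by (rule M.right_module) fact
  then show "\<lbrakk>m \<in> carrier (fobj M x); s \<in> carrier (fobj R x)\<rbrakk> \<Longrightarrow> pact M x m s \<in> carrier (fobj M x)"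
    by (rule right_module.act_closed)
qed

lemma presheaf_module_arr:
  assumes "presheaf_module k C R M" "f \<in> Arr C"
  shows "farr M f = Arrow (fobj M (Cod C f)) (fobj M (Dom C f)) (fn (farr M f))"
    "fn (farr M f) \<in> kmod_hom k (fobj M (Cod C f)) (fobj M (Dom C f))"
    "fn (farr M f) \<in> additive_hom (fobj M (Cod C f)) (fobj M (Dom C f))"
    "m \<in> carrier (fobj M (Cod C f)) \<Longrightarrow> fn (farr M f) m \<in> carrier (fobj M (Dom C f))"
proof -
  interpret M: presheaf_module k C R M by fact
  have "farr M f \<in> Arr (kmod_category k)" "src (farr M f) = fobj M (Cod C f)"
    "trg (farr M f) = fobj M (Dom C f)"
    using M.M.farr_closed M.M.Dom_farr[of f] M.M.Cod_farr[of f] assms(2)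
    by (auto simp: kmod_sel(3,4) opposite_def)
  then show "farr M f = Arrow (fobj M (Cod C f)) (fobj M (Dom C f)) (fn (farr M f))"
    and hom: "fn (farr M f) \<in> kmod_hom k (fobj M (Cod C f)) (fobj M (Dom C f))"
    by (auto simp: kmod_sel)
  then show "fn (farr M f) \<in> additive_hom (fobj M (Cod C f)) (fobj M (Dom C f))"
    "m \<in> carrier (fobj M (Cod C f)) \<Longrightarrow> fn (farr M f) m \<in> carrier (fobj M (Dom C f))"
    by (auto simp: kmod_hom_def additive_hom_def)
qed

lemma presheaf_module_Id:
  assumes "presheaf_module k C R M" "x \<in> Obj C" "m \<in> carrier (fobj M x)"
  shows "fn (farr M (Id C x)) m = m"
proof -
  interpret M: presheaf_module k C R M by fact
  show ?thesis using M.M.farr_Id[of x] assms(2,3) by (auto simp: kmod_sel opposite_def)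
qed

lemma presheaf_module_Comp:
  assumes "presheaf_module k C R M" "g \<in> Arr C" "f \<in> Arr C" "Dom C g = Cod C f"
    "m \<in> carrier (fobj M (Cod C g))"
  shows "fn (farr M (Comp C g f)) m = fn (farr M f) (fn (farr M g) m)"
proof -
  interpret M: presheaf_module k C R M by fact
  have "src (farr M g) = fobj M (Cod C g)" using presheaf_module_arr(1)[OF assms(1,2)] by (metis arrow.sel(1))
  then show ?thesis using M.M.farr_Comp[of f g] assms by (auto simp: kmod_sel opposite_def compose_def)
qed

text \<open>
  The restriction arrows are given by functions \<open>\<rho> f\<close>, cut down to their domains to become
  extensional; the functor laws then concern values of \<open>\<rho>\<close> only.
\<close>

lemma presheaf_moduleI:
  assumes obj: "\<And>x. x \<in> Obj C \<Longrightarrow> module k (fobj M x)"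
    "\<And>x. x \<in> Obj C \<Longrightarrow> right_module (fobj R x) (fobj M x) (pact M x)"
    and smult: "\<And>x c m s. \<lbrakk>x \<in> Obj C; c \<in> carrier k; m \<in> carrier (fobj M x); s \<in> carrier (fobj R x)\<rbrakk>
      \<Longrightarrow> pact M x m (c \<odot>\<^bsub>fobj R x\<^esub> s) = c \<odot>\<^bsub>fobj M x\<^esub> pact M x m s"
      "\<And>x c m s. \<lbrakk>x \<in> Obj C; c \<in> carrier k; m \<in> carrier (fobj M x); s \<in> carrier (fobj R x)\<rbrakk>
      \<Longrightarrow> pact M x (c \<odot>\<^bsub>fobj M x\<^esub> m) s = c \<odot>\<^bsub>fobj M x\<^esub> pact M x m s"
    and arr: "\<And>f. f \<in> Arr C \<Longrightarrow> farr M f = Arrow (fobj M (Cod C f)) (fobj M (Dom C f))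
        (restrict (\<rho> f) (carrier (fobj M (Cod C f))))"
      "\<And>f. f \<in> Arr C \<Longrightarrow> \<rho> f \<in> kmod_hom k (fobj M (Cod C f)) (fobj M (Dom C f))"
      "\<And>x m. \<lbrakk>x \<in> Obj C; m \<in> carrier (fobj M x)\<rbrakk> \<Longrightarrow> \<rho> (Id C x) m = m"
      "\<And>g f m. \<lbrakk>g \<in> Arr C; f \<in> Arr C; Dom C g = Cod C f; m \<in> carrier (fobj M (Cod C g))\<rbrakk>
        \<Longrightarrow> \<rho> (Comp C g f) m = \<rho> f (\<rho> g m)"
    and restrict_pact: "\<And>f m s. \<lbrakk>f \<in> Arr C; m \<in> carrier (fobj M (Cod C f)); s \<in> carrier (fobj R (Cod C f))\<rbrakk>
      \<Longrightarrow> \<rho> f (pact M (Cod C f) m s) = pact M (Dom C f) (\<rho> f m) (res f s)"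
  shows "presheaf_module k C R M"
proof -
  have \<rho>_closed: "\<rho> f m \<in> carrier (fobj M (Dom C f))"
    if "f \<in> Arr C" "m \<in> carrier (fobj M (Cod C f))" for f m
    using arr(2)[of f] that by (auto simp: kmod_hom_def additive_hom_def)
  have "cfunctor_axioms (opposite C) (kmod_category k) M"
    using obj(1) arr \<rho>_closed
    by unfold_locales
      (auto simp: Arrow_in_kmod kmod_sel(1,3-) opposite_def restrict_kmod_hom compose_def fun_eq_iff)
  then interpret M: cfunctor "opposite C" "kmod_category k" M
    by (simp add: cfunctor_def category_opposite C.category_axioms category_kmod)
  show ?thesis
    using obj smult arr restrict_pact right_module.act_closed[OF obj(2)]
    by (intro presheaf_module.intro M.cfunctor_axioms presheaf_module_axioms.intro) auto
qed

lemma category_pmod: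
  "category (pmod_category k C R :: (('o, 'c, 'k, 'r, 'm) pmodule, ('o, 'c, 'k, 'r, 'm) pmod_arrow) category)"
proof -
  interpret K: category "kmod_category k :: (('k, 'm) module, ('k, 'm) kmod_arrow) category"
    by (rule category_kmod)
  have Id_hom: "(\<lambda>x\<in>Obj C. Id (kmod_category k) (fobj M x)) \<in> pmod_hom k C R M M"
    if M: "presheaf_module k C R M" for M :: "('o, 'c, 'k, 'r, 'm) pmodule"
    unfolding pmod_hom_iff[OF M M]
    using presheaf_module_obj[OF M] presheaf_module_arr(4)[OF M] module.smult_closed[OF presheaf_module_obj(1)[OF M]]
    by (auto simp: kmod_sel kmod_hom_def additive_hom_ident)
  have Comp_hom: "(\<lambda>x\<in>Obj C. Comp (kmod_category k) (T x) (S x)) \<in> pmod_hom k C R L N"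
    if L: "presheaf_module k C R L" and M: "presheaf_module k C R M" and N: "presheaf_module k C R N"
      and S: "S \<in> pmod_hom k C R L M" and T: "T \<in> pmod_hom k C R M N"
    for L M N :: "('o, 'c, 'k, 'r, 'm) pmodule" and S T
  proof -
    note L' = presheaf_module_obj[OF L] presheaf_module_arr(4)[OF L]
    show ?thesis
      using S T unfolding pmod_hom_iff[OF L M] pmod_hom_iff[OF M N] pmod_hom_iff[OF L N]
      using L' module.smult_closed[OF L'(1)]
      by (auto simp: kmod_sel kmod_hom_def additive_hom_compose compose_def additive_homD)
        (auto simp: additive_hom_def compose_def abelian_monoid.a_closed[OF abelian_group.axioms(1)] Pi_def)
  qed
  have ext: "T \<in> extensional (Obj C)" if "T \<in> pmod_hom k C R M N" for T and M N :: "('o, 'c, 'k, 'r, 'm) pmodule"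
    using that by (simp add: pmod_hom_def)
  have comp: "T x \<in> Arr (kmod_category k)" "src (T x) = fobj M x" "trg (T x) = fobj N x"
    if "T \<in> pmod_hom k C R M N" "x \<in> Obj C" for T x and M N :: "('o, 'c, 'k, 'r, 'm) pmodule"
    using that nat_trans.component_closed[of "opposite C" "kmod_category k" M N T x]
      nat_trans.Dom_component[of "opposite C" "kmod_category k" M N T x]
      nat_trans.Cod_component[of "opposite C" "kmod_category k" M N T x]
    by (simp_all add: pmod_hom_def opposite_def kmod_sel(3,4))
  note K = K.Comp_Id[unfolded kmod_sel(3)] K.Id_Comp[unfolded kmod_sel(4)] K.Comp_assoc[unfolded kmod_sel(3,4)]
  show ?thesis
  proof (unfold_locales, goal_cases)
    case (9 f)
    then obtain M N T where f: "f = Arrow M N T" "T \<in> pmod_hom k C R M N"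
      by (auto simp: pmod_sel)
    then have "(\<lambda>x\<in>Obj C. Comp (kmod_category k) (T x) (Id (kmod_category k) (fobj M x))) = T"
      using K(1)[OF comp(1)[OF f(2)]] comp(2)[OF f(2)]
      by (intro extensionalityI[of _ "Obj C"]) (simp_all add: ext)
    then show ?case by (simp add: pmod_sel f(1) cong: restrict_cong)
  next
    case (10 f)
    then obtain M N T where f: "f = Arrow M N T" "T \<in> pmod_hom k C R M N"
      by (auto simp: pmod_sel)
    then have "(\<lambda>x\<in>Obj C. Comp (kmod_category k) (Id (kmod_category k) (fobj N x)) (T x)) = T"
      using K(2)[OF comp(1)[OF f(2)]] comp(3)[OF f(2)]
      by (intro extensionalityI[of _ "Obj C"]) (simp_all add: ext)
    then show ?case by (simp add: pmod_sel f(1) cong: restrict_cong)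
  next
    case (11 h g f)
    then obtain L M N P S T U where *: "f = Arrow L M S" "g = Arrow M N T" "h = Arrow N P U"
      "S \<in> pmod_hom k C R L M" "T \<in> pmod_hom k C R M N" "U \<in> pmod_hom k C R N P"
      by (auto simp: pmod_sel)
    then show ?case
      using comp[OF *(4)] comp[OF *(5)] comp[OF *(6)]
      by (simp add: pmod_sel(3-6) K(3) cong: restrict_cong)
  qed (auto simp: pmod_sel Id_hom intro: Comp_hom)
qed

text \<open>
  The pointwise inverses form a morphism again: applying the injective map \<open>T x\<close> turns each
  required identity into the corresponding one for \<open>T\<close>.
\<close>

lemma iso_pmod:
  assumes M: "presheaf_module k C R M" and N: "presheaf_module k C R N" and T: "T \<in> pmod_hom k C R M N"
    and bij: "\<And>x. x \<in> Obj C \<Longrightarrow> bij_betw (fn (T x)) (carrier (fobj M x)) (carrier (fobj N x))"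
  shows "iso_arr (pmod_category k C R) (Arrow M N T)"
proof -
  define i where "i x = inv_into (carrier (fobj M x)) (fn (T x))" for x
  define T' where "T' = (\<lambda>x\<in>Obj C. Arrow (fobj N x) (fobj M x) (restrict (i x) (carrier (fobj N x))))"
  note T_iff = T[unfolded pmod_hom_iff[OF M N]]
  have i: "i x n \<in> carrier (fobj M x)" "fn (T x) (i x n) = n" if "x \<in> Obj C" "n \<in> carrier (fobj N x)" for x n
    using bij[OF that(1)] that(2) unfolding i_def bij_betw_def
    by (metis inv_into_into, metis f_inv_into_f)
  have i': "i x (fn (T x) m) = m" if "x \<in> Obj C" "m \<in> carrier (fobj M x)" for x m
    using bij[OF that(1)] that(2) unfolding i_def bij_betw_def by (metis inv_into_f_f)
  have i_eq: "i x n = m" if "x \<in> Obj C" "m \<in> carrier (fobj M x)" "fn (T x) m = n" for x n m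
    using i' that by blast
  have hom: "i x \<in> kmod_hom k (fobj N x) (fobj M x)" if x: "x \<in> Obj C" for x
  proof -
    interpret Mx: module k "fobj M x" by (rule presheaf_module_obj[OF M x])
    have "fn (T x) \<in> kmod_hom k (fobj M x) (fobj N x)" using T_iff x by blast
    then show ?thesis
      using i[OF x] by (auto simp: kmod_hom_def additive_hom_def intro!: i_eq[OF x])
  qed
  have "T' \<in> pmod_hom k C R N M"
    unfolding pmod_hom_iff[OF N M]
  proof (intro conjI ballI)
    fix f n assume f: "f \<in> Arr C" and n: "n \<in> carrier (fobj N (Cod C f))"
    have "fn (farr M f) (i (Cod C f) n) = i (Dom C f) (fn (farr N f) n)"
      using i[OF _ n] f T_iff presheaf_module_arr(4)[OF M f]
      by (intro i_eq[symmetric]) (auto, metis)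
    then show "fn (farr M f) (fn (T' (Cod C f)) n) = fn (T' (Dom C f)) (fn (farr N f) n)"
      using f n presheaf_module_arr(4)[OF N f] by (simp add: T'_def)
  next
    fix x n s assume x: "x \<in> Obj C" and n: "n \<in> carrier (fobj N x)" and s: "s \<in> carrier (fobj R x)"
    have "i x (pact N x n s) = pact M x (i x n) s"
      using i[OF x n] x s T_iff presheaf_module_obj(4)[OF M x] by (intro i_eq) auto
    then show "fn (T' x) (pact N x n s) = pact M x (fn (T' x) n) s"
      using x n s presheaf_module_obj(4)[OF N x] by (simp add: T'_def)
  qed (use hom presheaf_module_obj(1)[OF N] in \<open>auto simp: T'_def restrict_kmod_hom\<close>)
  moreover have "Comp (kmod_category k) (T' x) (T x) = Id (kmod_category k) (fobj M x)"
    "Comp (kmod_category k) (T x) (T' x) = Id (kmod_category k) (fobj N x)" if x: "x \<in> Obj C" for x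
    using T_iff i i' x pmod_homD(4)[OF M N T x] by (auto simp: T'_def kmod_sel compose_def fun_eq_iff)
  ultimately show ?thesis
    using M N T by (intro iso_arrI[of _ _ "Arrow N M T'"]) (auto simp: pmod_sel cong: restrict_cong)
qed

end

section \<open>From modules over the skew category algebra to presheaves of modules\<close>

lemma (in category) Comp_Id_Id: "x \<in> Obj C \<Longrightarrow> Comp C (Id C x) (Id C x) = Id C x"
  by (metis Comp_Id Id_closed Dom_Id)

lemma (in skew_setting) R_scalar:
  assumes "x \<in> Obj C" "c \<in> carrier k" "r \<in> carrier (fobj R x)"
  shows "(c \<odot>\<^bsub>fobj R x\<^esub> \<one>\<^bsub>fobj R x\<^esub>) \<otimes>\<^bsub>fobj R x\<^esub> r = c \<odot>\<^bsub>fobj R x\<^esub> r"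
    "r \<otimes>\<^bsub>fobj R x\<^esub> (c \<odot>\<^bsub>fobj R x\<^esub> \<one>\<^bsub>fobj R x\<^esub>) = c \<odot>\<^bsub>fobj R x\<^esub> r"
  using assms assoc_algebra.smult_mult_l[OF R_algebra] assoc_algebra.smult_mult_r[OF R_algebra] by simp_all

text \<open>
  The direct summand \<open>N 1\<^sub>x\<close> cut out by the idempotent \<open>1\<^sub>x = 1 Id\<^sub>x\<close>, on which a scalar \<open>c\<close> of \<open>k\<close>
  acts as \<open>(c 1) Id\<^sub>x\<close>. The multiplicative fields of the record are placeholders.
\<close>

definition stalk ::
    "('o, 'c) category \<Rightarrow> ('o, 'c, 'k, 'r) alg_presheaf \<Rightarrow> ('c \<Rightarrow> 'r, 'm) rmodule \<Rightarrow> 'o \<Rightarrow> ('k, 'm) module"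
  where "stalk C R N x = \<lparr>
    carrier = {n \<in> carrier N. ract N n (skew_elem C R \<one>\<^bsub>fobj R x\<^esub> (Id C x)) = n},
    monoid.mult = undefined,
    one = undefined,
    zero = \<zero>\<^bsub>N\<^esub>,
    add = add N,
    smult = (\<lambda>c n. ract N n (skew_elem C R (c \<odot>\<^bsub>fobj R x\<^esub> \<one>\<^bsub>fobj R x\<^esub>) (Id C x)))\<rparr>"

definition presheaf_of ::
    "('o, 'c) category \<Rightarrow> ('o, 'c, 'k, 'r) alg_presheaf \<Rightarrow> ('c \<Rightarrow> 'r, 'm) rmodule \<Rightarrow> ('o, 'c, 'k, 'r, 'm) pmodule"
  where "presheaf_of C R N = \<lparr>
    fobj = stalk C R N,
    farr = (\<lambda>f. Arrow (stalk C R N (Cod C f)) (stalk C R N (Dom C f))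
      (\<lambda>n\<in>carrier (stalk C R N (Cod C f)). ract N n (skew_elem C R \<one>\<^bsub>fobj R (Dom C f)\<^esub> f))),
    pact = (\<lambda>x n s. ract N n (skew_elem C R s (Id C x)))\<rparr>"

lemma presheaf_of_sel [simp]:
  "fobj (presheaf_of C R N) = stalk C R N"
  "farr (presheaf_of C R N) f = Arrow (stalk C R N (Cod C f)) (stalk C R N (Dom C f))
      (\<lambda>n\<in>carrier (stalk C R N (Cod C f)). ract N n (skew_elem C R \<one>\<^bsub>fobj R (Dom C f)\<^esub> f))"
  "pact (presheaf_of C R N) = (\<lambda>x n s. ract N n (skew_elem C R s (Id C x)))"
  by (simp_all add: presheaf_of_def)

locale skew_rmodule = skew_setting k C R
  for k :: "'k ring" and C :: "('o, 'c) category" and R :: "('o, 'c, 'k, 'r) alg_presheaf" +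
  fixes N :: "('c \<Rightarrow> 'r, 'm) rmodule"
  assumes N: "right_module (skew_algebra C R) N (ract N)"
begin

abbreviation "proj x \<equiv> skew_elem C R \<one>\<^bsub>fobj R x\<^esub> (Id C x)"

lemma N_group: "abelian_group N"
  using N by (simp add: right_module_def)

lemma N_closed [simp]:
  "\<zero>\<^bsub>N\<^esub> \<in> carrier N" "\<lbrakk>m \<in> carrier N; n \<in> carrier N\<rbrakk> \<Longrightarrow> m \<oplus>\<^bsub>N\<^esub> n \<in> carrier N"
  using N_group by (simp_all add: abelian_group.axioms(1) abelian_monoid.zero_closed abelian_monoid.a_closed)

lemma act_closed [simp]: "n \<in> carrier N \<Longrightarrow> u \<in> carrier S \<Longrightarrow> ract N n u \<in> carrier N"
  using right_module.act_closed[OF N] by simp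

lemma act_mult: "\<lbrakk>n \<in> carrier N; u \<in> carrier S; v \<in> carrier S\<rbrakk> \<Longrightarrow>
    ract N (ract N n u) v = ract N n (u \<otimes>\<^bsub>A\<^esub> v)"
  using right_module.act_mult[OF N] by simp

lemma act_add:
  "\<lbrakk>m \<in> carrier N; n \<in> carrier N; u \<in> carrier S\<rbrakk> \<Longrightarrow> ract N (m \<oplus>\<^bsub>N\<^esub> n) u = ract N m u \<oplus>\<^bsub>N\<^esub> ract N n u"
  "\<lbrakk>n \<in> carrier N; u \<in> carrier S; v \<in> carrier S\<rbrakk> \<Longrightarrow> ract N n (u \<oplus>\<^bsub>S\<^esub> v) = ract N n u \<oplus>\<^bsub>N\<^esub> ract N n v"
  using right_module.act_add_l[OF N] right_module.act_add_r[OF N] by simp_all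

lemma act_hom_l: "u \<in> carrier S \<Longrightarrow> (\<lambda>n. ract N n u) \<in> additive_hom N N"
  by (simp add: additive_hom_def act_add)

lemma act_hom_r: "n \<in> carrier N \<Longrightarrow> (\<lambda>u. ract N n u) \<in> additive_hom S N"
  by (simp add: additive_hom_def act_add)

lemma act_zero [simp]: "u \<in> carrier S \<Longrightarrow> ract N \<zero>\<^bsub>N\<^esub> u = \<zero>\<^bsub>N\<^esub>"
    "n \<in> carrier N \<Longrightarrow> ract N n \<zero>\<^bsub>S\<^esub> = \<zero>\<^bsub>N\<^esub>"
  using additive_hom_zero[OF N_group N_group act_hom_l] additive_hom_zero[OF S_group N_group act_hom_r]
  by auto

lemma act_E_E:
  assumes "n \<in> carrier N" "g \<in> Arr C" "s \<in> carrier (fobj R (Dom C g))" "f \<in> Arr C"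
    "r \<in> carrier (fobj R (Dom C f))"
  shows "ract N (ract N n (E s g)) (E r f) =
    (if Dom C g = Cod C f then ract N n (E (res f s \<otimes>\<^bsub>fobj R (Dom C f)\<^esub> r) (Comp C g f)) else \<zero>\<^bsub>N\<^esub>)"
  using assms by (simp add: act_mult E_mult)

lemmas [simp] = C.Comp_Id_Id

lemma stalk_sel [simp]:
  "n \<in> carrier (stalk C R N x) \<longleftrightarrow> n \<in> carrier N \<and> ract N n (proj x) = n"
  "\<zero>\<^bsub>stalk C R N x\<^esub> = \<zero>\<^bsub>N\<^esub>" "m \<oplus>\<^bsub>stalk C R N x\<^esub> n = m \<oplus>\<^bsub>N\<^esub> n"
  "c \<odot>\<^bsub>stalk C R N x\<^esub> n = ract N n (E (c \<odot>\<^bsub>fobj R x\<^esub> \<one>\<^bsub>fobj R x\<^esub>) (Id C x))"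
  by (simp_all add: stalk_def)

lemma act_E_stalk [simp]:
  "\<lbrakk>n \<in> carrier N; f \<in> Arr C; r \<in> carrier (fobj R (Dom C f)); x = Dom C f\<rbrakk> \<Longrightarrow>
    ract N (ract N n (E r f)) (proj x) = ract N n (E r f)"
  by (simp add: act_E_E)

lemma act_Id_stalk [simp]:
  "\<lbrakk>n \<in> carrier N; x \<in> Obj C; r \<in> carrier (fobj R x)\<rbrakk> \<Longrightarrow>
    ract N (ract N n (E r (Id C x))) (proj x) = ract N n (E r (Id C x))"
  by (simp add: act_E_E)

text \<open>
  The idempotents are orthogonal: \<open>n = n 1\<^sub>x\<close>, while \<open>1\<^sub>x * r f = 0\<close> unless \<open>f\<close> ends at \<open>x\<close>.
\<close>

lemma act_stalk_other:
  assumes "n \<in> carrier (stalk C R N x)" "x \<in> Obj C" "f \<in> Arr C" "r \<in> carrier (fobj R (Dom C f))" "Cod C f \<noteq> x"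
  shows "ract N n (E r f) = \<zero>\<^bsub>N\<^esub>"
  using act_E_E[of n "Id C x" "\<one>\<^bsub>fobj R x\<^esub>" f r] assms by simp

lemma stalk_group:
  assumes x: "x \<in> Obj C"
  shows "abelian_group (stalk C R N x)"
proof -
  interpret N: abelian_group N by (rule N_group)
  show ?thesis
  proof (rule abelian_groupI, goal_cases)
    case (6 n)
    have n: "n \<in> carrier N" "ract N n (proj x) = n" using 6 by auto
    have "ract N (\<ominus>\<^bsub>N\<^esub> n) (proj x) \<oplus>\<^bsub>N\<^esub> n = ract N (\<ominus>\<^bsub>N\<^esub> n \<oplus>\<^bsub>N\<^esub> n) (proj x)"
      using n x by (simp add: act_add)
    also have "\<dots> = \<zero>\<^bsub>N\<^esub>"
      using n x by (simp add: N.l_neg)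
    finally have "ract N (\<ominus>\<^bsub>N\<^esub> n) (proj x) = \<ominus>\<^bsub>N\<^esub> n"
      using n x by (intro N.minus_equality[symmetric]) auto
    then show ?case using n by (intro bexI[of _ "\<ominus>\<^bsub>N\<^esub> n"]) (auto simp: N.l_neg)
  qed (use x in \<open>auto simp: act_add N.a_ac\<close>)
qed

lemma stalk_right_module:
  assumes x: "x \<in> Obj C"
  shows "right_module (fobj R x) (stalk C R N x) (\<lambda>n s. ract N n (E s (Id C x)))"
proof (intro right_module.intro right_module_axioms.intro stalk_group x R_ring, goal_cases)
  case (3 m a b)
  then show ?case
    using x additive_homD(2)[OF E_additive[of "Id C x"], of a b] by (simp add: act_add)
qed (use x in \<open>auto simp: act_add act_E_E\<close>)

lemma stalk_module:
  assumes x: "x \<in> Obj C"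
  shows "module k (stalk C R N x)"
proof -
  interpret Rx: module k "fobj R x" using x by (rule R_module)
  interpret RM: right_module "fobj R x" "stalk C R N x" "\<lambda>n s. ract N n (E s (Id C x))"
    using x by (rule stalk_right_module)
  show ?thesis
  proof (rule moduleI, goal_cases)
    case (4 a b n)
    then show ?case
      using RM.act_add_r[of n "a \<odot>\<^bsub>fobj R x\<^esub> \<one>\<^bsub>fobj R x\<^esub>" "b \<odot>\<^bsub>fobj R x\<^esub> \<one>\<^bsub>fobj R x\<^esub>"] x
      by (simp add: Rx.smult_l_distr)
  next
    \<comment> \<open>A right action composes scalars in the opposite order; commutativity of \<open>k\<close> repairs this.\<close>
    case (6 a b n)
    then show ?case
      using x by (simp add: act_E_E R_scalar Rx.smult_assoc1[symmetric] Rx.R.m_comm)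
  qed (use x RM.act_one RM.act_closed RM.act_add_l stalk_group cring in auto)
qed

lemma presheaf_of_closed: "presheaf_module k C R (presheaf_of C R N)"
proof (rule presheaf_moduleI[where \<rho> = "\<lambda>f n. ract N n (E \<one>\<^bsub>fobj R (Dom C f)\<^esub> f)"], goal_cases)
  case (1 x)
  then show ?case by (simp add: stalk_module)
next
  case (2 x)
  then show ?case using stalk_right_module[of x] by simp
next
  case (6 f)
  then show ?case
    by (auto simp: kmod_hom_def additive_hom_def act_add act_E_E)
qed (auto simp: act_E_E R_scalar)

text \<open>
  The idempotents \<open>1\<^sub>x\<close> add up to the identity of \<open>R[C]\<close>, so \<open>N\<close> is the sum of its stalks.
\<close>

lemma decompose: "n \<in> carrier N \<Longrightarrow> (\<Oplus>\<^bsub>N\<^esub>x\<in>Obj C. ract N n (proj x)) = n"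
  using additive_hom_finsum[OF S_group N_group act_hom_r finite_Obj, of n proj]
    right_module.act_one[OF N, of n] by simp

end

context skew_setting
begin

definition presheaf_functor ::
    "(('c \<Rightarrow> 'r, 'm) rmodule, ('c \<Rightarrow> 'r, 'm) rmod_arrow, ('o, 'c, 'k, 'r, 'm) pmodule, ('o, 'c, 'k, 'r, 'm) pmod_arrow) func"
  where "presheaf_functor = \<lparr>
    fobj = presheaf_of C R,
    farr = (\<lambda>a. Arrow (presheaf_of C R (src a)) (presheaf_of C R (trg a))
      (\<lambda>x\<in>Obj C. Arrow (stalk C R (src a) x) (stalk C R (trg a) x) (restrict (fn a) (carrier (stalk C R (src a) x)))))\<rparr>"

lemma skew_rmoduleI: "right_module A N (ract N) \<Longrightarrow> skew_rmodule k C R N"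
  using skew_setting_axioms by (simp add: skew_rmodule_def skew_rmodule_axioms_def)

text \<open>
  A linear map \<open>h : M \<rightarrow> N\<close> commutes with \<open>1\<^sub>x\<close> and thus restricts to \<open>M 1\<^sub>x \<rightarrow> N 1\<^sub>x\<close>; it commutes
  with \<open>1 f\<close> and \<open>s Id\<^sub>x\<close>, so these restrictions are natural and linear over \<open>R(x)\<close>.
\<close>

lemma presheaf_functor: "cfunctor (rmod_category A) (pmod_category k C R) presheaf_functor"
proof -
  have stalk_closed: "h n \<in> carrier (stalk C R N x)"
    if M: "right_module A M (ract M)" and N: "right_module A N (ract N)" and "h \<in> rmod_hom A M N"
      "x \<in> Obj C" "n \<in> carrier (stalk C R M x)" for M N :: "('c \<Rightarrow> 'r, 'm) rmodule" and h x n
  proof -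
    interpret M: skew_rmodule k C R M by (rule skew_rmoduleI) fact
    interpret N: skew_rmodule k C R N by (rule skew_rmoduleI) fact
    show ?thesis
      using that by (auto simp: rmod_hom_def additive_hom_def) (metis C.Id_closed C.Dom_Id E_closed R_closed(2))
  qed
  have hom: "(\<lambda>x\<in>Obj C. Arrow (stalk C R M x) (stalk C R N x) (restrict h (carrier (stalk C R M x))))
      \<in> pmod_hom k C R (presheaf_of C R M) (presheaf_of C R N)"
    if M: "right_module A M (ract M)" and N: "right_module A N (ract N)" and h: "h \<in> rmod_hom A M N"
    for M N :: "('c \<Rightarrow> 'r, 'm) rmodule" and h
  proof -
    interpret M: skew_rmodule k C R M by (rule skew_rmoduleI) fact
    interpret N: skew_rmodule k C R N by (rule skew_rmoduleI) fact
    have hE: "h (ract M n (E r f)) = ract N (h n) (E r f)" "h n \<in> carrier N"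
      if "n \<in> carrier M" "f \<in> Arr C" "r \<in> carrier (fobj R (Dom C f))" for n f r
      using h that by (auto simp: rmod_hom_def additive_hom_def)
    have h_closed: "h n \<in> carrier N" if "n \<in> carrier M" for n
      using h that by (auto simp: rmod_hom_def additive_hom_def)
    have kh: "h \<in> kmod_hom k (stalk C R M x) (stalk C R N x)" if x: "x \<in> Obj C" for x
      using h stalk_closed[OF M N h x] x by (auto simp: kmod_hom_def additive_hom_def rmod_hom_def)
    show ?thesis
      unfolding pmod_hom_iff[OF M.presheaf_of_closed N.presheaf_of_closed]
      using kh stalk_closed[OF M N h]
      by (auto simp: restrict_kmod_hom M.stalk_module hE h_closed)
  qed
  have "cfunctor_axioms (rmod_category A) (pmod_category k C R) presheaf_functor"
  proof (unfold_locales, goal_cases)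
    case (1 N)
    then show ?case
      by (simp add: presheaf_functor_def rmod_sel pmod_sel skew_rmodule.presheaf_of_closed[OF skew_rmoduleI])
  next
    case (2 f)
    then show ?case
      by (auto simp: presheaf_functor_def rmod_sel pmod_sel skew_rmodule.presheaf_of_closed[OF skew_rmoduleI] hom)
  next
    case (5 N)
    then interpret N: skew_rmodule k C R N by (intro skew_rmoduleI) (simp add: rmod_sel)
    show ?case
      by (auto simp: presheaf_functor_def rmod_sel pmod_sel kmod_sel intro!: restrict_ext)
  next
    case (6 g f)
    then obtain L M N h h' where *: "f = Arrow L M h" "g = Arrow M N h'"
      "right_module A L (ract L)" "right_module A M (ract M)" "right_module A N (ract N)"
      "h \<in> rmod_hom A L M" by (auto simp: rmod_sel)
    interpret L: skew_rmodule k C R L by (rule skew_rmoduleI) fact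
    interpret M: skew_rmodule k C R M by (rule skew_rmoduleI) fact
    show ?case using stalk_closed[OF *(3,4,6)]
      by (auto simp: presheaf_functor_def rmod_sel pmod_sel kmod_sel compose_def * intro!: restrict_ext)
  qed (auto simp: presheaf_functor_def rmod_sel pmod_sel)
  then show ?thesis by (simp add: cfunctor_def category_rmod category_pmod)
qed

text \<open>
  By \<open>decompose\<close>, an additive map on \<open>M\<close> is determined by its restrictions to the summands \<open>M 1\<^sub>x\<close>.
\<close>

lemma presheaf_functor_faithful:
  assumes "a \<in> Arr (rmod_category A)" "b \<in> Arr (rmod_category A)"
    and "Dom (rmod_category A) a = Dom (rmod_category A) b" "Cod (rmod_category A) a = Cod (rmod_category A) b"
    and eq: "farr presheaf_functor a = farr presheaf_functor b"
  shows "a = b"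
proof -
  obtain M N h h' where ab: "a = Arrow M N h" "b = Arrow M N h'"
    and M: "right_module A M (ract M)" and N: "right_module A N (ract N)"
    and h: "h \<in> additive_hom M N" "h' \<in> additive_hom M N"
    and ext: "h \<in> extensional (carrier M)" "h' \<in> extensional (carrier M)"
    using assms(1-4) by (auto simp: rmod_sel rmod_hom_def)
  interpret M: skew_rmodule k C R M by (rule skew_rmoduleI) fact
  interpret N: skew_rmodule k C R N by (rule skew_rmoduleI) fact
  have *: "h n = h' n" if "x \<in> Obj C" "n \<in> carrier (stalk C R M x)" for x n
    using fun_cong[OF arg_cong[OF eq, of fn], of x] that
    by (simp add: presheaf_functor_def ab) (metis restrict_apply' M.stalk_sel(1))
  have "h n = h' n" if n: "n \<in> carrier M" for n
  proof -
    have "h (\<Oplus>\<^bsub>M\<^esub>x\<in>Obj C. ract M n (M.proj x)) = (\<Oplus>\<^bsub>N\<^esub>x\<in>Obj C. h (ract M n (M.proj x)))"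
      by (rule additive_hom_finsum[OF M.N_group N.N_group h(1) finite_Obj]) (use n in auto)
    moreover have
      "h' (\<Oplus>\<^bsub>M\<^esub>x\<in>Obj C. ract M n (M.proj x)) = (\<Oplus>\<^bsub>N\<^esub>x\<in>Obj C. h' (ract M n (M.proj x)))"
      by (rule additive_hom_finsum[OF M.N_group N.N_group h(2) finite_Obj]) (use n in auto)
    moreover have "(\<Oplus>\<^bsub>N\<^esub>x\<in>Obj C. h (ract M n (M.proj x))) = (\<Oplus>\<^bsub>N\<^esub>x\<in>Obj C. h' (ract M n (M.proj x)))"
    proof (rule abelian_monoid.finsum_cong'[OF abelian_group.axioms(1)[OF N.N_group] refl])
      show "(\<lambda>x. h' (ract M n (M.proj x))) \<in> Obj C \<rightarrow> carrier N"
        using n additive_homD(1)[OF h(2)] by simp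
      show "h (ract M n (M.proj x)) = h' (ract M n (M.proj x))" if "x \<in> Obj C" for x
        using *[OF that, of "ract M n (M.proj x)"] n that by simp
    qed
    ultimately show ?thesis using M.decompose[OF n] by simp
  qed
  then have "h = h'" using ext by (intro extensionalityI[of _ "carrier M"]) auto
  then show ?thesis by (simp add: ab)
qed

text \<open>
  The preimage of \<open>T\<close> is \<open>h n = (\<Sum>x. T\<^sub>x (n 1\<^sub>x))\<close>. For \<open>f : x \<rightarrow> y\<close>, linearity with respect to \<open>r f\<close>
  uses the factorization \<open>r f = 1\<^sub>y * (1 f) * (r Id\<^sub>x)\<close>: only the summand \<open>T\<^sub>y (n 1\<^sub>y)\<close> of \<open>h n\<close> sees
  \<open>r f\<close>, naturality moves \<open>T\<close> past \<open>1 f\<close>, and linearity over \<open>R(x)\<close> moves it past \<open>r Id\<^sub>x\<close>.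
\<close>

lemma presheaf_functor_full:
  fixes M N :: "('c \<Rightarrow> 'r, 'm) rmodule"
  assumes M: "right_module A M (ract M)" and N: "right_module A N (ract N)"
    and T: "T \<in> pmod_hom k C R (presheaf_of C R M) (presheaf_of C R N)"
  shows "\<exists>h \<in> rmod_hom A M N. h \<in> extensional (carrier M) \<and>
    farr presheaf_functor (Arrow M N h) = Arrow (presheaf_of C R M) (presheaf_of C R N) T"
proof -
  interpret M: skew_rmodule k C R M by (rule skew_rmoduleI) fact
  interpret N: skew_rmodule k C R N by (rule skew_rmoduleI) fact
  interpret NG: abelian_group N by (rule N.N_group)
  note T_iff = T[unfolded pmod_hom_iff[OF M.presheaf_of_closed N.presheaf_of_closed]]
  note T_hom = pmod_homD[OF M.presheaf_of_closed N.presheaf_of_closed T, simplified]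
  have T_closed: "fn (T x) n \<in> carrier N" "ract N (fn (T x) n) (N.proj x) = fn (T x) n"
    if "x \<in> Obj C" "n \<in> carrier M" "ract M n (M.proj x) = n" for x n
    using T_hom(4)[OF that(1)] that by auto
  have T_add: "fn (T x) (m \<oplus>\<^bsub>M\<^esub> n) = fn (T x) m \<oplus>\<^bsub>N\<^esub> fn (T x) n"
    if "x \<in> Obj C" "m \<in> carrier (stalk C R M x)" "n \<in> carrier (stalk C R M x)" for x m n
    using additive_homD(2)[OF T_hom(2)[OF that(1)] that(2,3)] by simp
  have T_nat: "fn (T (Dom C f)) (ract M m (E \<one>\<^bsub>fobj R (Dom C f)\<^esub> f))
      = ract N (fn (T (Cod C f)) m) (E \<one>\<^bsub>fobj R (Dom C f)\<^esub> f)"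
    if "f \<in> Arr C" "m \<in> carrier (stalk C R M (Cod C f))" for f m
  proof -
    have "fn (farr (presheaf_of C R N) f) (fn (T (Cod C f)) m) = fn (T (Dom C f)) (fn (farr (presheaf_of C R M) f) m)"
      using T_iff that by (metis presheaf_of_sel(1))
    then show ?thesis using that T_closed[of "Cod C f" m] by simp
  qed
  have T_zero: "fn (T x) \<zero>\<^bsub>M\<^esub> = \<zero>\<^bsub>N\<^esub>" if "x \<in> Obj C" for x
    using additive_hom_zero[OF M.stalk_group[OF that] N.stalk_group[OF that] T_hom(2)[OF that]] by simp
  define h where "h n = (\<Oplus>\<^bsub>N\<^esub>x\<in>Obj C. fn (T x) (ract M n (M.proj x)))" for n
  have h_closed: "h n \<in> carrier N" if "n \<in> carrier M" for n
    using that T_closed by (auto simp: h_def intro!: NG.finsum_closed)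
  have h_additive: "h \<in> additive_hom M N"
  proof -
    have "h (m \<oplus>\<^bsub>M\<^esub> n) = (\<Oplus>\<^bsub>N\<^esub>x\<in>Obj C. fn (T x) (ract M m (M.proj x)) \<oplus>\<^bsub>N\<^esub> fn (T x) (ract M n (M.proj x)))"
      if "m \<in> carrier M" "n \<in> carrier M" for m n
      unfolding h_def using that T_closed
      by (intro NG.finsum_cong') (auto simp: M.act_add T_add)
    then show ?thesis
      using h_closed T_closed by (auto simp: additive_hom_def h_def NG.finsum_addf Pi_def)
  qed
  have h_stalk: "h n = fn (T x) n" if "x \<in> Obj C" "n \<in> carrier (stalk C R M x)" for x n
    unfolding h_def using that M.act_stalk_other[OF that(2,1)] T_zero T_closed
    by (subst NG.finsum_only[of _ x]) (auto simp: finite_Obj)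
  have h_E: "h (ract M n (E r f)) = ract N (h n) (E r f)"
    if n: "n \<in> carrier M" and f: "f \<in> Arr C" and r: "r \<in> carrier (fobj R (Dom C f))" for n r f
  proof -
    define m where "m = ract M n (M.proj (Cod C f))"
    have m: "m \<in> carrier M" "ract M m (M.proj (Cod C f)) = m" using n f by (auto simp: m_def)
    have nm: "ract M n (E r f) = ract M (ract M m (E \<one>\<^bsub>fobj R (Dom C f)\<^esub> f)) (E r (Id C (Dom C f)))"
      using n f r by (simp add: m_def M.act_E_E)
    have other: "ract N (fn (T x) (ract M n (M.proj x))) (E r f) = \<zero>\<^bsub>N\<^esub>"
      if "x \<in> Obj C" "x \<noteq> Cod C f" for x
      using that n f r T_closed by (intro N.act_stalk_other[of _ x]) auto
    have "h (ract M n (E r f)) = fn (T (Dom C f)) (ract M n (E r f))"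
      using n f r by (intro h_stalk) auto
    also have "\<dots> = ract N (fn (T (Dom C f)) (ract M m (E \<one>\<^bsub>fobj R (Dom C f)\<^esub> f))) (E r (Id C (Dom C f)))"
      unfolding nm using T_hom(5)[of "Dom C f" "ract M m (E \<one>\<^bsub>fobj R (Dom C f)\<^esub> f)" r] m f r by simp
    also have "fn (T (Dom C f)) (ract M m (E \<one>\<^bsub>fobj R (Dom C f)\<^esub> f))
        = ract N (fn (T (Cod C f)) m) (E \<one>\<^bsub>fobj R (Dom C f)\<^esub> f)"
      using T_nat m f by simp
    also have "ract N \<dots> (E r (Id C (Dom C f))) = ract N (fn (T (Cod C f)) m) (E r f)"
      using m f r T_closed[of "Cod C f" m] by (simp add: N.act_E_E)
    also have "\<dots> = (\<Oplus>\<^bsub>N\<^esub>x\<in>Obj C. ract N (fn (T x) (ract M n (M.proj x))) (E r f))"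
      unfolding m_def using n f r T_closed other
      by (subst NG.finsum_only[of _ "Cod C f"]) (auto simp: finite_Obj)
    also have "\<dots> = ract N (h n) (E r f)"
      unfolding h_def using n f r T_closed
      by (subst additive_hom_finsum[OF N.N_group N.N_group N.act_hom_l]) (auto simp: finite_Obj)
    finally show ?thesis .
  qed
  have h_act: "h (ract M n u) = ract N (h n) u" if n: "n \<in> carrier M" and u: "u \<in> carrier S" for n u
    using u
  proof (induction u rule: skew_induct)
    case zero
    then show ?case using additive_hom_zero[OF M.N_group N.N_group h_additive] n h_closed by simp
  next
    case (add u v)
    then show ?case using n h_closed additive_homD(2)[OF h_additive] by (simp add: M.act_add N.act_add)
  next
    case (elem f r)
    then show ?case using h_E n by blast
  qed
  have "h \<in> rmod_hom A M N" using h_additive h_act by (simp add: rmod_hom_def)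
  moreover have "(\<lambda>x\<in>Obj C. Arrow (stalk C R M x) (stalk C R N x) (restrict (restrict h (carrier M)) (carrier (stalk C R M x)))) = T"
  proof (rule extensionalityI[of _ "Obj C"])
    fix x assume x: "x \<in> Obj C"
    have "restrict (restrict h (carrier M)) (carrier (stalk C R M x)) = fn (T x)"
      using T_hom(3)[OF x] h_stalk[OF x]
      by (intro extensionalityI[of _ "carrier (stalk C R M x)"]) auto
    then show "(\<lambda>x\<in>Obj C. Arrow (stalk C R M x) (stalk C R N x) (restrict (restrict h (carrier M)) (carrier (stalk C R M x)))) x = T x"
      using T_hom(1)[OF x] x by simp
  qed (use T_iff in auto)
  ultimately show ?thesis
    by (intro bexI[of _ "restrict h (carrier M)"])
      (auto simp: presheaf_functor_def restrict_rmod_hom[OF M])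
qed

end

section \<open>From presheaves of modules to modules over the skew category algebra\<close>

text \<open>
  Families indexed by \<open>X\<close> are coded one coordinate at a time, by means of an injection of pairs
  \<open>'m \<times> 'm \<rightarrow> 'm\<close>. This embeds the direct sum of the modules \<open>M(x)\<close> into the type of their elements.
\<close>

lemma inj_on_finite_power:
  assumes "finite X" and inf: "infinite (UNIV :: 'm set)"
  shows "\<exists>\<iota> :: ('o \<Rightarrow> 'm) \<Rightarrow> 'm. inj_on \<iota> (extensional X)"
  using assms(1)
proof (induction X)
  case empty
  then show ?case by (auto simp: inj_on_def)
next
  case (insert x X)
  then obtain \<iota> :: "('o \<Rightarrow> 'm) \<Rightarrow> 'm" where \<iota>: "inj_on \<iota> (extensional X)" by blast
  obtain p :: "'m \<times> 'm \<Rightarrow> 'm" where p: "inj p"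
    using card_of_Times_same_infinite[OF inf] unfolding card_of_ordIso[symmetric] bij_betw_def by auto
  have "inj_on (\<lambda>m. p (m x, \<iota> (restrict m X))) (extensional (insert x X))"
  proof (rule inj_onI)
    fix m n assume mn: "m \<in> extensional (insert x X)" "n \<in> extensional (insert x X)"
      "p (m x, \<iota> (restrict m X)) = p (n x, \<iota> (restrict n X))"
    then have "m x = n x" "restrict m X = restrict n X"
      using injD[OF p mn(3)] inj_onD[OF \<iota>, of "restrict m X" "restrict n X"] by auto
    then show "m = n"
      using mn(1,2) by (intro extensionalityI[of m "insert x X" n]) (auto dest: fun_cong simp: restrict_def, metis)
  qed
  then show ?case by blast
qed

definition transport :: "('v \<Rightarrow> 'm) \<Rightarrow> 'v ring \<Rightarrow> ('v \<Rightarrow> 'r \<Rightarrow> 'v) \<Rightarrow> ('r, 'm) rmodule" where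
  "transport \<iota> V act = (let \<kappa> = inv_into (carrier V) \<iota> in \<lparr>
    carrier = \<iota> ` carrier V,
    monoid.mult = undefined,
    one = undefined,
    zero = \<iota> \<zero>\<^bsub>V\<^esub>,
    add = (\<lambda>a b. \<iota> (\<kappa> a \<oplus>\<^bsub>V\<^esub> \<kappa> b)),
    ract = (\<lambda>a r. \<iota> (act (\<kappa> a) r))\<rparr>)"

lemma transport_sel:
  assumes "inj_on \<iota> (carrier V)"
  shows "carrier (transport \<iota> V act) = \<iota> ` carrier V" "\<zero>\<^bsub>transport \<iota> V act\<^esub> = \<iota> \<zero>\<^bsub>V\<^esub>"
    "\<lbrakk>v \<in> carrier V; w \<in> carrier V\<rbrakk> \<Longrightarrow> \<iota> v \<oplus>\<^bsub>transport \<iota> V act\<^esub> \<iota> w = \<iota> (v \<oplus>\<^bsub>V\<^esub> w)"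
    "v \<in> carrier V \<Longrightarrow> ract (transport \<iota> V act) (\<iota> v) r = \<iota> (act v r)"
  using assms by (simp_all add: transport_def Let_def)

lemma right_module_transport:
  assumes "right_module A V act" "inj_on \<iota> (carrier V)"
  shows "right_module A (transport \<iota> V act) (ract (transport \<iota> V act))"
proof -
  interpret V: right_module A V act by fact
  note sel = transport_sel[OF assms(2)]
  have "abelian_group (transport \<iota> V act)"
  proof (rule abelian_groupI, goal_cases)
    case (6 x)
    then obtain v where "v \<in> carrier V" "x = \<iota> v" by (auto simp: sel)
    then show ?case by (intro bexI[of _ "\<iota> (\<ominus>\<^bsub>V\<^esub> v)"]) (auto simp: sel V.M.l_neg)
  qed (auto simp: sel V.M.a_ac)
  then show ?thesis
    by (intro right_module.intro right_module_axioms.intro V.A.ring_axioms)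
      (auto simp: sel V.act_closed V.act_add_l V.act_add_r V.act_mult V.act_one)
qed

definition direct_sum :: "('o, 'c) category \<Rightarrow> ('o, 'c, 'k, 'r, 'm) pmodule \<Rightarrow> ('o \<Rightarrow> 'm) ring" where
  "direct_sum C M = \<lparr>
    carrier = (\<Pi>\<^sub>E x\<in>Obj C. carrier (fobj M x)),
    monoid.mult = undefined,
    one = undefined,
    zero = (\<lambda>x\<in>Obj C. \<zero>\<^bsub>fobj M x\<^esub>),
    add = (\<lambda>m n. \<lambda>x\<in>Obj C. m x \<oplus>\<^bsub>fobj M x\<^esub> n x)\<rparr>"

definition summand :: "('o, 'c) category \<Rightarrow> ('o, 'c, 'k, 'r, 'm) pmodule \<Rightarrow> 'o \<Rightarrow> 'm \<Rightarrow> 'o \<Rightarrow> 'm" where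
  "summand C M x a = (\<lambda>y\<in>Obj C. if y = x then a else \<zero>\<^bsub>fobj M y\<^esub>)"

locale skew_pmodule = skew_setting k C R
  for k :: "'k ring" and C :: "('o, 'c) category" and R :: "('o, 'c, 'k, 'r) alg_presheaf" +
  fixes M :: "('o, 'c, 'k, 'r, 'm) pmodule"
  assumes M: "presheaf_module k C R M"
begin

abbreviation "V \<equiv> direct_sum C M"
abbreviation "rho f \<equiv> fn (farr M f)"

lemmas M_group = presheaf_module_obj(2)[OF M]
lemmas M_right_module = presheaf_module_obj(3)[OF M]
lemmas rho_hom = presheaf_module_arr(3)[OF M]

lemma M_closed [simp]:
  assumes "x \<in> Obj C"
  shows "\<zero>\<^bsub>fobj M x\<^esub> \<in> carrier (fobj M x)"
    "\<lbrakk>a \<in> carrier (fobj M x); b \<in> carrier (fobj M x)\<rbrakk> \<Longrightarrow> a \<oplus>\<^bsub>fobj M x\<^esub> b \<in> carrier (fobj M x)"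
    "a \<in> carrier (fobj M x) \<Longrightarrow> \<zero>\<^bsub>fobj M x\<^esub> \<oplus>\<^bsub>fobj M x\<^esub> a = a"
    "a \<in> carrier (fobj M x) \<Longrightarrow> s \<in> carrier (fobj R x) \<Longrightarrow> pact M x a s \<in> carrier (fobj M x)"
    "a \<in> carrier (fobj M x) \<Longrightarrow> pact M x a \<one>\<^bsub>fobj R x\<^esub> = a"
  using M_group[OF assms] presheaf_module_obj(4)[OF M assms] right_module.act_one[OF M_right_module[OF assms]]
  by (simp_all add: abelian_group.axioms(1) abelian_monoid.zero_closed abelian_monoid.a_closed abelian_monoid.l_zero)

lemma rho_closed [simp]:
  "\<lbrakk>f \<in> Arr C; a \<in> carrier (fobj M (Cod C f))\<rbrakk> \<Longrightarrow> rho f a \<in> carrier (fobj M (Dom C f))"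
  by (rule presheaf_module_arr(4)[OF M])

lemma rho_zero [simp]: "f \<in> Arr C \<Longrightarrow> rho f \<zero>\<^bsub>fobj M (Cod C f)\<^esub> = \<zero>\<^bsub>fobj M (Dom C f)\<^esub>"
  using additive_hom_zero[OF M_group M_group rho_hom] by auto

lemma pact_hom_r: "\<lbrakk>x \<in> Obj C; a \<in> carrier (fobj M x)\<rbrakk> \<Longrightarrow> pact M x a \<in> additive_hom (fobj R x) (fobj M x)"
  using right_module.act_add_r[OF M_right_module] by (simp add: additive_hom_def)

lemma pact_hom_l: "\<lbrakk>x \<in> Obj C; s \<in> carrier (fobj R x)\<rbrakk> \<Longrightarrow>
    (\<lambda>a. pact M x a s) \<in> additive_hom (fobj M x) (fobj M x)"
  using right_module.act_add_l[OF M_right_module] by (simp add: additive_hom_def)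

lemma pact_zero [simp]: "\<lbrakk>x \<in> Obj C; s \<in> carrier (fobj R x)\<rbrakk> \<Longrightarrow> pact M x \<zero>\<^bsub>fobj M x\<^esub> s = \<zero>\<^bsub>fobj M x\<^esub>"
  using additive_hom_zero[OF M_group M_group pact_hom_l] by auto

lemma V_carrier: "m \<in> carrier V \<longleftrightarrow> m \<in> extensional (Obj C) \<and> (\<forall>x\<in>Obj C. m x \<in> carrier (fobj M x))"
  by (auto simp: direct_sum_def PiE_def Pi_def)

lemma V_add: "m \<oplus>\<^bsub>V\<^esub> n = (\<lambda>x\<in>Obj C. m x \<oplus>\<^bsub>fobj M x\<^esub> n x)"
  and V_zero: "\<zero>\<^bsub>V\<^esub> = (\<lambda>x\<in>Obj C. \<zero>\<^bsub>fobj M x\<^esub>)"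
  by (simp_all add: direct_sum_def)

lemma V_group: "abelian_group V"
proof (rule abelian_groupI, goal_cases)
  case (3 m n p)
  then show ?case
    by (auto simp: V_carrier V_add fun_eq_iff abelian_monoid.a_assoc[OF abelian_group.axioms(1)[OF M_group]])
next
  case (4 m n)
  then show ?case
    by (auto simp: V_carrier V_add fun_eq_iff abelian_monoid.a_comm[OF abelian_group.axioms(1)[OF M_group]])
next
  case (5 m)
  then show ?case by (auto simp: V_carrier V_add V_zero fun_eq_iff extensional_def)
next
  case (6 m)
  then show ?case
    by (intro bexI[of _ "\<lambda>x\<in>Obj C. \<ominus>\<^bsub>fobj M x\<^esub> m x"])
      (auto simp: V_carrier V_add V_zero fun_eq_iff abelian_group.l_neg[OF M_group] abelian_group.a_inv_closed[OF M_group])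
qed (auto simp: V_carrier V_add V_zero)

lemma summand_hom: "x \<in> Obj C \<Longrightarrow> summand C M x \<in> additive_hom (fobj M x) V"
  by (auto simp: additive_hom_def V_carrier) (auto simp: summand_def V_add fun_eq_iff)

lemma summand_apply [simp]: "y \<in> Obj C \<Longrightarrow> summand C M x a y = (if y = x then a else \<zero>\<^bsub>fobj M y\<^esub>)"
  by (simp add: summand_def)

lemma summand_zero [simp]: "x \<in> Obj C \<Longrightarrow> summand C M x \<zero>\<^bsub>fobj M x\<^esub> = \<zero>\<^bsub>V\<^esub>"
  by (auto simp: summand_def V_zero)

lemma summand_closed [simp]: "\<lbrakk>x \<in> Obj C; a \<in> carrier (fobj M x)\<rbrakk> \<Longrightarrow> summand C M x a \<in> carrier V"
  by (rule additive_homD(1)[OF summand_hom])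

lemma V_apply: "m \<in> carrier V \<Longrightarrow> x \<in> Obj C \<Longrightarrow> m x \<in> carrier (fobj M x)"
  by (simp add: V_carrier)

text \<open>
  The result of acting on the family \<open>m\<close> with \<open>r f\<close>, for \<open>f : x \<rightarrow> y\<close>: the element \<open>M(f)(m\<^sub>y) r\<close> of
  \<open>M(x)\<close>, placed in the component at \<open>x\<close>.
\<close>

definition elem_act :: "('o \<Rightarrow> 'm) \<Rightarrow> 'c \<Rightarrow> 'r \<Rightarrow> 'o \<Rightarrow> 'm" where
  "elem_act m f r = summand C M (Dom C f) (pact M (Dom C f) (rho f (m (Cod C f))) r)"

definition sum_act :: "('o \<Rightarrow> 'm) \<Rightarrow> ('c \<Rightarrow> 'r) \<Rightarrow> 'o \<Rightarrow> 'm" where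
  "sum_act m = additive_extension V (elem_act m)"

lemma elem_act_hom_r: "\<lbrakk>m \<in> carrier V; f \<in> Arr C\<rbrakk> \<Longrightarrow> elem_act m f \<in> additive_hom (fobj R (Dom C f)) V"
  using additive_homD[OF pact_hom_r] additive_homD[OF summand_hom]
  by (simp add: additive_hom_def elem_act_def V_apply)

lemma elem_act_hom_l: "\<lbrakk>f \<in> Arr C; r \<in> carrier (fobj R (Dom C f))\<rbrakk> \<Longrightarrow> (\<lambda>m. elem_act m f r) \<in> additive_hom V V"
  using additive_homD[OF pact_hom_l] additive_homD[OF summand_hom] additive_homD[OF rho_hom]
  by (simp add: additive_hom_def elem_act_def V_apply V_add)

lemma sum_act_hom_r: "m \<in> carrier V \<Longrightarrow> sum_act m \<in> additive_hom S V"
  unfolding sum_act_def by (rule additive_extension[OF V_group elem_act_hom_r])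

lemma sum_act_hom_l: "u \<in> carrier S \<Longrightarrow> (\<lambda>m. sum_act m u) \<in> additive_hom V V"
  unfolding sum_act_def by (rule additive_extension_param[OF V_group _ elem_act_hom_l])

lemma sum_act_E: "\<lbrakk>m \<in> carrier V; f \<in> Arr C; r \<in> carrier (fobj R (Dom C f))\<rbrakk> \<Longrightarrow>
    sum_act m (E r f) = summand C M (Dom C f) (pact M (Dom C f) (rho f (m (Cod C f))) r)"
  unfolding sum_act_def elem_act_def[symmetric]
  by (rule additive_extension_elem[OF V_group elem_act_hom_r])

lemma sum_act_closed [simp]: "m \<in> carrier V \<Longrightarrow> u \<in> carrier S \<Longrightarrow> sum_act m u \<in> carrier V"
  by (rule additive_homD(1)[OF sum_act_hom_r])

lemma sum_act_zero [simp]: "m \<in> carrier V \<Longrightarrow> sum_act m \<zero>\<^bsub>S\<^esub> = \<zero>\<^bsub>V\<^esub>"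
    "u \<in> carrier S \<Longrightarrow> sum_act \<zero>\<^bsub>V\<^esub> u = \<zero>\<^bsub>V\<^esub>"
  using additive_hom_zero[OF S_group V_group sum_act_hom_r] additive_hom_zero[OF V_group V_group sum_act_hom_l]
  by auto

lemma sum_act_add:
  "\<lbrakk>m \<in> carrier V; n \<in> carrier V; u \<in> carrier S\<rbrakk> \<Longrightarrow> sum_act (m \<oplus>\<^bsub>V\<^esub> n) u = sum_act m u \<oplus>\<^bsub>V\<^esub> sum_act n u"
  "\<lbrakk>m \<in> carrier V; u \<in> carrier S; v \<in> carrier S\<rbrakk> \<Longrightarrow> sum_act m (u \<oplus>\<^bsub>S\<^esub> v) = sum_act m u \<oplus>\<^bsub>V\<^esub> sum_act m v"
  using additive_homD(2)[OF sum_act_hom_l, of u m n] additive_homD(2)[OF sum_act_hom_r, of m u v] by auto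

text \<open>
  Restriction along \<open>f\<close> is compatible with the actions, \<open>M(f)(a s) = M(f)(a) R(f)(s)\<close>; this is
  where the twist \<open>R(f)(s) r\<close> in the product of \<open>R[C]\<close> comes from.
\<close>

lemma sum_act_E_E:
  assumes m: "m \<in> carrier V" and g: "g \<in> Arr C" and s: "s \<in> carrier (fobj R (Dom C g))"
    and f: "f \<in> Arr C" and r: "r \<in> carrier (fobj R (Dom C f))"
  shows "sum_act (sum_act m (E s g)) (E r f) = sum_act m (E s g \<otimes>\<^bsub>A\<^esub> E r f)"
proof (cases "Dom C g = Cod C f")
  case True
  have "pact M (Dom C f) (rho f (pact M (Dom C g) (rho g (m (Cod C g))) s)) r
    = pact M (Dom C f) (pact M (Dom C f) (rho f (rho g (m (Cod C g)))) (res f s)) r"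
    using presheaf_module.restrict_pact[OF M f, of "rho g (m (Cod C g))" s] True m g s rho_closed[OF g]
    by (simp add: V_apply)
  also have "\<dots> = pact M (Dom C f) (rho f (rho g (m (Cod C g)))) (res f s \<otimes>\<^bsub>fobj R (Dom C f)\<^esub> r)"
    using True m g s f r rho_closed[OF g] by (subst right_module.act_mult[OF M_right_module]) (auto simp: V_apply)
  also have "rho f (rho g (m (Cod C g))) = rho (Comp C g f) (m (Cod C g))"
    using True m g f by (simp add: presheaf_module_Comp[OF M] V_apply)
  finally show ?thesis
    using True m g s f r rho_closed[OF g] by (simp add: sum_act_E E_mult V_apply)
next
  case False
  then show ?thesis using m g s f r by (simp add: sum_act_E E_mult V_apply)
qed

lemma sum_act_mult:
  assumes "m \<in> carrier V" "u \<in> carrier S" "v \<in> carrier S"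
  shows "sum_act (sum_act m u) v = sum_act m (u \<otimes>\<^bsub>A\<^esub> v)"
  using assms(2,3)
proof (induction u rule: skew_induct)
  case (elem g s)
  from elem(3) show ?case
  proof (induction v rule: skew_induct)
    case (elem f r)
    then show ?case using sum_act_E_E assms(1) \<open>g \<in> Arr C\<close> \<open>s \<in> carrier (fobj R (Dom C g))\<close> by blast
  qed (use elem assms(1) in \<open>simp_all add: A_zero_mult mult_add sum_act_add\<close>)
qed (use assms(1) in \<open>simp_all add: A_zero_mult mult_add sum_act_add\<close>)

text \<open>
  Acting with \<open>1\<^sub>x\<close> projects a family to its component at \<open>x\<close>, and a family is the sum of its
  components.
\<close>

lemma sum_act_one:
  assumes m: "m \<in> carrier V"
  shows "sum_act m \<one>\<^bsub>A\<^esub> = m"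
proof -
  have sm: "(\<lambda>x. summand C M x (m x)) \<in> Obj C \<rightarrow> carrier V" using m by (simp add: V_apply)
  have "sum_act m \<one>\<^bsub>A\<^esub> = (\<Oplus>\<^bsub>V\<^esub>x\<in>Obj C. sum_act m (E \<one>\<^bsub>fobj R x\<^esub> (Id C x)))"
    unfolding A_sel by (rule additive_hom_finsum[OF S_group V_group sum_act_hom_r[OF m] finite_Obj]) simp
  also have "\<dots> = (\<Oplus>\<^bsub>V\<^esub>x\<in>Obj C. summand C M x (m x))"
    using sm m by (intro abelian_monoid.finsum_cong'[OF abelian_group.axioms(1)[OF V_group] refl])
      (simp_all add: sum_act_E presheaf_module_Id[OF M] V_apply)
  also have "\<dots> = m"
  proof (rule extensionalityI[of _ "Obj C"])
    have "(\<Oplus>\<^bsub>V\<^esub>x\<in>Obj C. summand C M x (m x)) \<in> carrier V"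
      by (rule abelian_monoid.finsum_closed[OF abelian_group.axioms(1)[OF V_group] sm])
    then show "(\<Oplus>\<^bsub>V\<^esub>x\<in>Obj C. summand C M x (m x)) \<in> extensional (Obj C)" by (simp add: V_carrier)
    fix y assume y: "y \<in> Obj C"
    have "(\<lambda>m. m y) \<in> additive_hom V (fobj M y)"
      using y by (simp add: additive_hom_def V_apply V_add)
    then have "(\<Oplus>\<^bsub>V\<^esub>x\<in>Obj C. summand C M x (m x)) y = (\<Oplus>\<^bsub>fobj M y\<^esub>x\<in>Obj C. summand C M x (m x) y)"
      by (rule additive_hom_finsum[OF V_group M_group[OF y] _ finite_Obj sm])
    also have "\<dots> = summand C M y (m y) y"
      using y m finite_Obj
      by (intro abelian_monoid.finsum_only[OF abelian_group.axioms(1)[OF M_group[OF y]]]) (auto simp: V_apply)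
    finally show "(\<Oplus>\<^bsub>V\<^esub>x\<in>Obj C. summand C M x (m x)) y = m y" using y by simp
  qed (use m in \<open>simp add: V_carrier\<close>)
  finally show ?thesis .
qed

lemma sum_right_module: "right_module A V sum_act"
  using A_ring V_group sum_act_mult sum_act_one sum_act_add
  by (intro right_module.intro right_module_axioms.intro) (simp_all del: A_sel(4))

text \<open>
  As \<open>1\<^sub>x\<close> acts on the direct sum as the projection to the component at \<open>x\<close>, the stalk at \<open>x\<close> consists
  of the families concentrated at \<open>x\<close>, a copy of \<open>M(x)\<close>. The injection \<open>\<iota>\<close> moves the direct sum into
  the type \<open>'m\<close>, where the objects of the category of modules live.
\<close>

lemma essentially_surjective:
  fixes \<iota> :: "('o \<Rightarrow> 'm) \<Rightarrow> 'm"
  assumes \<iota>: "inj_on \<iota> (carrier V)"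
  shows "\<exists>N. right_module A N (ract N) \<and>
    (\<exists>T. iso_arr (pmod_category k C R) (Arrow M (presheaf_of C R N) T))"
proof -
  define N where "N = transport \<iota> V sum_act"
  have rN: "right_module A N (ract N)"
    unfolding N_def by (rule right_module_transport[OF sum_right_module \<iota>])
  interpret N: skew_rmodule k C R N by (rule skew_rmoduleI[OF rN])
  note sel = transport_sel[OF \<iota>, where act = sum_act, folded N_def]
  define T where "T = (\<lambda>x\<in>Obj C. Arrow (fobj M x) (stalk C R N x)
    (restrict (\<lambda>a. \<iota> (summand C M x a)) (carrier (fobj M x))))"
  have act: "ract N (\<iota> (summand C M x a)) (E r f) =
      (if Cod C f = x then \<iota> (summand C M (Dom C f) (pact M (Dom C f) (rho f a) r)) else \<iota> \<zero>\<^bsub>V\<^esub>)"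
    if "x \<in> Obj C" "a \<in> carrier (fobj M x)" "f \<in> Arr C" "r \<in> carrier (fobj R (Dom C f))" for x a f r
    using that by (auto simp: sel sum_act_E)
  have stalk: "\<iota> (summand C M x a) \<in> carrier (stalk C R N x)" if "x \<in> Obj C" "a \<in> carrier (fobj M x)" for x a
    using that act[OF that, of "Id C x" "\<one>\<^bsub>fobj R x\<^esub>"] by (simp add: sel presheaf_module_Id[OF M])
  have hom: "(\<lambda>a. \<iota> (summand C M x a)) \<in> kmod_hom k (fobj M x) (stalk C R N x)" if x: "x \<in> Obj C" for x
  proof -
    have "pact M x a (c \<odot>\<^bsub>fobj R x\<^esub> \<one>\<^bsub>fobj R x\<^esub>) = c \<odot>\<^bsub>fobj M x\<^esub> a"
      if "c \<in> carrier k" "a \<in> carrier (fobj M x)" for c a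
      using presheaf_module.pact_smult[OF M x that, of "\<one>\<^bsub>fobj R x\<^esub>"] that x by simp
    then show ?thesis
      using x stalk additive_homD(2)[OF summand_hom[OF x]]
      by (simp add: kmod_hom_def additive_hom_def act sel sum_act_E presheaf_module_Id[OF M])
  qed
  have T: "T \<in> pmod_hom k C R M (presheaf_of C R N)"
    unfolding pmod_hom_iff[OF M N.presheaf_of_closed]
    using hom stalk presheaf_module_obj(1)[OF M]
    by (simp add: T_def restrict_kmod_hom act presheaf_module_Id[OF M] del: N.stalk_sel(1))
  have bij: "bij_betw (fn (T x)) (carrier (fobj M x)) (carrier (fobj (presheaf_of C R N) x))" if x: "x \<in> Obj C" for x
  proof (rule bij_betw_imageI)
    show "inj_on (fn (T x)) (carrier (fobj M x))"
    proof (rule inj_onI)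
      fix a b assume "a \<in> carrier (fobj M x)" "b \<in> carrier (fobj M x)" "fn (T x) a = fn (T x) b"
      then have "summand C M x a = summand C M x b"
        using x inj_onD[OF \<iota>] by (simp add: T_def)
      then show "a = b" using x summand_apply[of x x] by metis
    qed
    have "n \<in> (\<lambda>a. \<iota> (summand C M x a)) ` carrier (fobj M x)" if n: "n \<in> carrier (stalk C R N x)" for n
    proof -
      obtain m where m: "m \<in> carrier V" "n = \<iota> m" using n by (auto simp: sel)
      have "n = ract N (\<iota> m) (N.proj x)" using n m by simp
      also have "\<dots> = \<iota> (summand C M x (m x))"
        using m x by (simp add: sel sum_act_E V_apply presheaf_module_Id[OF M])
      finally show ?thesis using V_apply[OF m(1) x] by blast
    qed
    then show "fn (T x) ` carrier (fobj M x) = carrier (fobj (presheaf_of C R N) x)"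
      using stalk x by (auto simp: T_def simp del: N.stalk_sel(1))
  qed
  show ?thesis
    using rN iso_pmod[OF M N.presheaf_of_closed T bij] by blast
qed

end

section \<open>The equivalence\<close>

theorem theoremA:
  fixes k :: "'k ring"
    and C :: "('o, 'c) category"
    and R :: "('o, 'c, 'k, 'r) alg_presheaf"
  assumes "cring k"
    and "category C"
    and "presheaf_of_algebras k C R"
    and "finite (Obj C)"
    and "infinite (UNIV :: 'm set)"
  shows "equivalent_categories
    (pmod_category k C R :: (('o, 'c, 'k, 'r, 'm) pmodule, ('o, 'c, 'k, 'r, 'm) pmod_arrow) category)
    (rmod_category (skew_algebra C R) :: (('c \<Rightarrow> 'r, 'm) rmodule, ('c \<Rightarrow> 'r, 'm) rmod_arrow) category)"
proof -
  interpret skew_setting k C R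
    using assms(1-4) by (simp add: skew_setting_def skew_setting_axioms_def)
  show ?thesis
  proof (rule equivalence_of_fully_faithful[OF presheaf_functor])
    fix N N' :: "('c \<Rightarrow> 'r, 'm) rmodule" and c :: "('o, 'c, 'k, 'r, 'm) pmod_arrow"
    assume N: "N \<in> Obj (rmod_category A)" "N' \<in> Obj (rmod_category A)" and "c \<in> Arr (pmod_category k C R)"
      "Dom (pmod_category k C R) c = fobj presheaf_functor N" "Cod (pmod_category k C R) c = fobj presheaf_functor N'"
    then obtain T where c: "c = Arrow (presheaf_of C R N) (presheaf_of C R N') T"
      "T \<in> pmod_hom k C R (presheaf_of C R N) (presheaf_of C R N')"
      by (auto simp: pmod_sel presheaf_functor_def)
    show "\<exists>a\<in>Arr (rmod_category A). Dom (rmod_category A) a = N \<and> Cod (rmod_category A) a = N'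
        \<and> farr presheaf_functor a = c"
      using presheaf_functor_full[OF _ _ c(2)] N unfolding c(1) rmod_sel by fastforce
  next
    fix M :: "('o, 'c, 'k, 'r, 'm) pmodule"
    assume "M \<in> Obj (pmod_category k C R)"
    then interpret M: skew_pmodule k C R M
      using skew_setting_axioms by (simp add: skew_pmodule_def skew_pmodule_axioms_def pmod_sel)
    obtain \<iota> :: "('o \<Rightarrow> 'm) \<Rightarrow> 'm" where "inj_on \<iota> (extensional (Obj C))"
      using inj_on_finite_power[OF assms(4,5)] by blast
    then have "inj_on \<iota> (carrier M.V)"
      by (rule inj_on_subset) (auto simp: M.V_carrier)
    from M.essentially_surjective[OF this]
    show "\<exists>N\<in>Obj (rmod_category A). \<exists>e. iso_arr (pmod_category k C R) e
        \<and> Dom (pmod_category k C R) e = M \<and> Cod (pmod_category k C R) e = fobj presheaf_functor N"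
      by (auto simp: rmod_sel pmod_sel presheaf_functor_def) (metis arrow.sel)
  qed (rule presheaf_functor_faithful)
qed

end
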